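(* Let $\mathcal{G}$ be a minor-closed class of coloured ribbon graphs (closed under edge deletion and edge contraction). Then there is a unique map $U: \mathcal{G}\rightarrow \mathbb{Z}[\alpha, \beta, \gamma, a_{\mathrm{bs}},a_{\mathrm{bp}}^{1/2},a_{\mathrm{olc}}, a_{\mathrm{olh}}^{1/2}, b_{\mathrm{bs}},b_{\mathrm{bp}}^{1/2},b_{\mathrm{olc}}, b_{\mathrm{olh}}^{1/2}]$ such that \[ U(\mathbb{G}) = \begin{cases} a_{i}U(\mathbb{G}\backslash e)+b_{j}U(\mathbb{G}/e) & \text{if } e \text{ is of type }(i,j), \\ \alpha^{n}\beta^{m} \gamma^v & \text{if } \mathbb{G} \text{ is edgeless, with } v \text{ vertices, } n \text{ vertex colour classes and } m \text{ boundary colour classes,} \end{cases} \] where in the recursion $a_{\mathrm{nl}}=a_{\mathrm{bp}}^{1/2}a_{\mathrm{olh}}^{1/2}$ and $b_{\mathrm{nl}}=b_{\mathrm{bp}}^{1/2}b_{\mathrm{olh}}^{1/2}$. Moreover, \[ U(\mathbb{G})= \alpha^{k(\mathbb{G}/\mathcal{V})} \beta^{k(\mathbb{G}^*/\mathcal{B})}\gamma^{v(\mathbb{G})-\rho(\mathbb{G})} b_{\mathrm{bs}}^{r_1(\mathbb{G})} b_{\mathrm{bp}}^{r_2(\mathbb{G})} a_{\mathrm{olc}}^{r_3(\mathbb{G})} a_{\mathrm{olh}}^{r_4(\mathbb{G})}\; T_{ps} \left(\mathbb{G} ; \frac{\alpha \gamma\, a_{\mathrm{bs}}}{b_{\mathrm{bs}}},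 \frac{\gamma\,a_{\mathrm{bp}}}{b_{\mathrm{bp}}}, \frac{\beta\gamma\, b_{\mathrm{olc}}}{a_{\mathrm{olc}}}, \frac{\gamma\,b_{\mathrm{olh}}}{a_{\mathrm{olh}}} \right). \]
   Context: A coloured ribbon graph $\mathbb{G}=(V,E)$ is a ribbon graph together with a vertex colouring $\mathcal{V}$ (a partition of $V$ into colour classes) and a boundary colouring $\mathcal{B}$ (a partition of the set of boundary components into colour classes). Deletion and contraction of an edge act on the underlying ribbon graph in the usual way; under contraction, vertex colour classes of the endpoints merge (and new vertices created inherit the class), under deletion boundary colour classes of the boundary components touching the edge merge (and newly created boundary components inherit the class). There are five connected coloured ribbon graphs with one edge: $\mathrm{bs}$ (a non-loop edge whose two end vertices have different colours), $\mathrm{bp}$ (a non-loop edge whose two end vertices have the same colour), $\mathrm{olc}$ (an orientable loop whose two boundary components have different colours), $\mathrm{olh}$ (an orientable loop whose two boundary components have the same colour), and $\mathrm{nl}$ (a non-orientable loop). An edge $e$ is of type $(i,j)$, $i,j\in\{\mathrm{bs},\mathrm{bp},\mathrm{olc},\mathrm{olh},\mathrm{nl}\}$, if $(\mathbb{G}/(E\setminus e),\mathbb{G}\backslash (E\setminus e))$ equals $(i,j)$ after disregarding isolated vertices. Notation: for $A\subseteq E$, $r(A)$, $k(A)$ are rank and number of components of the underlying abstract spanning subgraph; $b(A)$ is the number of boundary components of the ribbon subgraph $(V,A)$; $\rho(A)=\tfrac12(|A|+|V|-b(A))$ (equivalently rank plus half the Euler genus of $(V,A)$), $\rho(\mathbb{G})=\rho(E)$;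 $v(\mathbb{G})=|V|$. $\mathbb{G}/\mathcal{V}$ is the abstract graph whose vertices are the vertex colour classes with adjacency induced by the edges of $\mathbb{G}$; $\mathbb{G}^*/\mathcal{B}$ is the abstract graph whose vertices are the boundary colour classes, with an edge between the classes of the boundary components meeting each edge of $\mathbb{G}$. With $A^c=E\setminus A$, $r_1(A)=r_{\mathbb{G}/\mathcal{V}}(A)$, $r_2(A)=\rho(A)-r_{\mathbb{G}/\mathcal{V}}(A)$, $r_3(A)=r_{\mathbb{G}^*/\mathcal{B}}(E)-r_{\mathbb{G}^*/\mathcal{B}}(A^c)$, $r_4(A)=|A|+r_{\mathbb{G}^*/\mathcal{B}}(A^c)-r_{\mathbb{G}^*/\mathcal{B}}(E)-\rho(A)$, and $r_i(\mathbb{G})=r_i(E)$. The Tutte polynomial of a coloured ribbon graph is $T_{ps}(\mathbb{G};w,x,y,z)=\sum_{A\subseteq E} w^{r_1(E)-r_1(A)}x^{r_2(E)-r_2(A)}y^{r_3(A)}z^{r_4(A)}$. *)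

theory Defs
  imports Complex_Main "HOL-Library.Poly_Mapping" "HOL-Library.Disjoint_Sets" "HOL-Library.FuncSet"
begin

section \<open>Abstract multigraphs\<close>

record ('v, 'e) multigraph =
  mverts :: "'v set"
  medges :: "'e set"
  ends :: "'e \<Rightarrow> 'v set"

text \<open>
  All edge subsets \<open>A\<close> below stand for the spanning subgraph with edge set \<open>A\<close>.
\<close>

definition madj :: "('v, 'e) multigraph \<Rightarrow> 'e set \<Rightarrow> ('v \<times> 'v) set" where
  "madj H A = {(u, v). \<exists>e\<in>A. u \<in> ends H e \<and> v \<in> ends H e}"

definition mcomponents :: "('v, 'e) multigraph \<Rightarrow> 'e set \<Rightarrow> 'v set set" where
  "mcomponents H A = mverts H // (madj H A)\<^sup>*"

definition mrank :: "('v, 'e) multigraph \<Rightarrow> 'e set \<Rightarrow> rat" where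
  "mrank H A = of_nat (card (mverts H)) - of_nat (card (mcomponents H A))"

definition mcomps :: "('v, 'e) multigraph \<Rightarrow> nat" where
  "mcomps H = card (mcomponents H (medges H))"


section \<open>Ribbon graphs\<close>

text \<open>
  A ribbon graph is encoded by finitely many marked points on the boundary circles of its vertex
  discs. Going around such a circle, the points cut it alternately into arcs, which avoid the edge
  ribbons, and segments. The map \<open>arc\<close> sends a point to the other end of its arc, and \<open>vstep\<close> sends it
  to the other end of its segment; so the vertices are the orbits of \<open>arc\<close> and \<open>vstep\<close>.
  A segment is either an end of an edge ribbon, or blank (nothing is attached to it). At a corner
  \<open>p\<close> of an edge ribbon, \<open>bstep p\<close> is the other end of the side of that ribbon which starts
  at \<open>p\<close>; at an end point of a blank segment, \<open>bstep\<close> agrees with \<open>vstep\<close>. So the boundary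
  components are the orbits of \<open>arc\<close> and \<open>bstep\<close>. An edge is identified with the set of the four
  corners \<open>p\<close>, \<open>vstep p\<close>, \<open>bstep p\<close>, \<open>vstep (bstep p)\<close> of its ribbon.

  This is the usual encoding by three fixed-point free involutions (graph-encoded maps), except for
  the blank segments. These carry no information; they are there so that isolated vertices
  are represented too (each is then a vertex and a boundary component at the same time) and
  every vertex and every boundary component is a set of points.
\<close>

record 'a ribbon_graph =
  points :: "'a set"
  arc :: "'a \<Rightarrow> 'a"
  vstep :: "'a \<Rightarrow> 'a"
  bstep :: "'a \<Rightarrow> 'a"

definition pairing_on :: "'a set \<Rightarrow> ('a \<Rightarrow> 'a) \<Rightarrow> bool" where
  "pairing_on P f \<longleftrightarrow> (\<forall>p\<in>P. f p \<in> P \<and> f p \<noteq> p \<and> f (f p) = p)"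

definition ribbon_graph :: "('a, 'm) ribbon_graph_scheme \<Rightarrow> bool" where
  "ribbon_graph G \<longleftrightarrow> finite (points G) \<and>
     pairing_on (points G) (arc G) \<and> pairing_on (points G) (vstep G) \<and>
     pairing_on (points G) (bstep G) \<and>
     (\<forall>p\<in>points G. vstep G (bstep G p) = bstep G (vstep G p))"

definition orbits :: "'a set \<Rightarrow> ('a \<Rightarrow> 'a) \<Rightarrow> ('a \<Rightarrow> 'a) \<Rightarrow> 'a set set" where
  "orbits P f g = P // ({(p, f p) |p. p \<in> P} \<union> {(p, g p) |p. p \<in> P})\<^sup>*"

definition verts :: "('a, 'm) ribbon_graph_scheme \<Rightarrow> 'a set set" where
  "verts G = orbits (points G) (arc G) (vstep G)"

definition bdrys :: "('a, 'm) ribbon_graph_scheme \<Rightarrow> 'a set set" where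
  "bdrys G = orbits (points G) (arc G) (bstep G)"

definition edges :: "('a, 'm) ribbon_graph_scheme \<Rightarrow> 'a set set" where
  "edges G = (\<lambda>p. {p, vstep G p, bstep G p, vstep G (bstep G p)}) ` {p \<in> points G. vstep G p \<noteq> bstep G p}"

text \<open>
  Deleting the edges in \<open>D\<close> makes their ends blank, so that the boundary now follows the
  boundary circles of the vertices there.
  Dually, contracting \<open>e\<close> leaves the boundary components as they are, and the new vertices
  are obtained by following the sides of \<open>e\<close> instead of its ends: one glues a disc to each boundary
  component of the ribbon subgraph consisting of \<open>e\<close> and its end vertices, and then removes
  the interior of that subgraph.
\<close>

definition del_ribbons :: "('a, 'm) ribbon_graph_scheme \<Rightarrow> 'a set set \<Rightarrow> ('a, 'm) ribbon_graph_scheme" where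
  "del_ribbons G D = G\<lparr>bstep := (\<lambda>p. if p \<in> \<Union>D then vstep G p else bstep G p)\<rparr>"

definition contr_ribbon :: "('a, 'm) ribbon_graph_scheme \<Rightarrow> 'a set \<Rightarrow> ('a, 'm) ribbon_graph_scheme" where
  "contr_ribbon G e = G\<lparr>vstep := (\<lambda>p. if p \<in> e then bstep G p else vstep G p)\<rparr>"

definition bcount :: "('a, 'm) ribbon_graph_scheme \<Rightarrow> 'a set set \<Rightarrow> nat" where
  "bcount G A = card (bdrys (del_ribbons G (edges G - A)))"

definition rho :: "('a, 'm) ribbon_graph_scheme \<Rightarrow> 'a set set \<Rightarrow> rat" where
  "rho G A = (of_nat (card A) + of_nat (card (verts G)) - of_nat (bcount G A)) / 2"


section \<open>Coloured ribbon graphs\<close>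

record 'a coloured_ribbon_graph = "'a ribbon_graph" +
  vclasses :: "'a set set set"
  bclasses :: "'a set set set"

definition coloured_ribbon_graph :: "'a coloured_ribbon_graph \<Rightarrow> bool" where
  "coloured_ribbon_graph G \<longleftrightarrow> ribbon_graph G \<and>
     partition_on (verts G) (vclasses G) \<and> partition_on (bdrys G) (bclasses G)"

text \<open>
  A vertex or boundary component \<open>c\<close> (a set of points) is incident with \<open>e\<close> iff \<open>c \<inter> e \<noteq> {}\<close>.
  \<open>recolour e S' K\<close>: given the colour classes \<open>K\<close> before the operation at \<open>e\<close> and the set \<open>S'\<close> of
  vertices (boundary components) after it, the classes containing something incident with \<open>e\<close>
  merge, and what is newly created at \<open>e\<close> replaces there what was at \<open>e\<close> before.
\<close>

definition recolour :: "'a set \<Rightarrow> 'a set set \<Rightarrow> 'a set set set \<Rightarrow> 'a set set set" where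
  "recolour e S' K =
     {C \<in> K. \<forall>c\<in>C. c \<inter> e = {}} \<union>
     {{c \<in> \<Union>{C \<in> K. \<exists>c\<in>C. c \<inter> e \<noteq> {}}. c \<inter> e = {}} \<union> {c \<in> S'. c \<inter> e \<noteq> {}}}"

definition delete :: "'a set \<Rightarrow> 'a coloured_ribbon_graph \<Rightarrow> 'a coloured_ribbon_graph" where
  "delete e G = (del_ribbons G {e})
     \<lparr>bclasses := recolour e (bdrys (del_ribbons G {e})) (bclasses G)\<rparr>"

definition contract :: "'a set \<Rightarrow> 'a coloured_ribbon_graph \<Rightarrow> 'a coloured_ribbon_graph" where
  "contract e G = (contr_ribbon G e)
     \<lparr>vclasses := recolour e (verts (contr_ribbon G e)) (vclasses G)\<rparr>"

definition minor_closed :: "'a coloured_ribbon_graph set \<Rightarrow> bool" where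
  "minor_closed \<G> \<longleftrightarrow> (\<forall>G\<in>\<G>. \<forall>e\<in>edges G. delete e G \<in> \<G> \<and> contract e G \<in> \<G>)"

text \<open>The graphs \<open>G/V\<close> and \<open>G\<^sup>*/B\<close>; edges keep their names.\<close>

definition vgraph :: "'a coloured_ribbon_graph \<Rightarrow> ('a set set, 'a set) multigraph" where
  "vgraph G = \<lparr>mverts = vclasses G, medges = edges G,
     ends = (\<lambda>e. {C \<in> vclasses G. \<exists>v\<in>C. v \<inter> e \<noteq> {}})\<rparr>"

definition bgraph :: "'a coloured_ribbon_graph \<Rightarrow> ('a set set, 'a set) multigraph" where
  "bgraph G = \<lparr>mverts = bclasses G, medges = edges G,
     ends = (\<lambda>e. {C \<in> bclasses G. \<exists>f\<in>C. f \<inter> e \<noteq> {}})\<rparr>"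


section \<open>Edge types\<close>

datatype etype = Bs | Bp | Olc | Olh | Nl

definition loop :: "'a coloured_ribbon_graph \<Rightarrow> 'a set \<Rightarrow> bool" where
  "loop G e \<longleftrightarrow> card {v \<in> verts G. v \<inter> e \<noteq> {}} = 1"

text \<open>
  A loop \<open>e\<close> at \<open>v\<close> is orientable iff its ribbon and the disc \<open>v\<close> have compatible orientations. Let \<open>S\<close>
  be the set of points of \<open>v\<close> at which an arc starts, for one of the two orientations of the
  boundary circle of \<open>v\<close>. The ribbon is untwisted iff its sides join points in \<open>S\<close> to points not in \<open>S\<close>.
\<close>

definition orientable_loop :: "'a coloured_ribbon_graph \<Rightarrow> 'a set \<Rightarrow> bool" where
  "orientable_loop G e \<longleftrightarrow> loop G e \<and>
     (\<exists>S. (\<forall>v\<in>verts G. v \<inter> e \<noteq> {} \<longrightarrow>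
              (\<forall>p\<in>v. (arc G p \<in> S \<longleftrightarrow> p \<notin> S) \<and> (vstep G p \<in> S \<longleftrightarrow> p \<notin> S))) \<and>
          (\<forall>p\<in>e. bstep G p \<in> S \<longleftrightarrow> p \<notin> S))"

text \<open>Intended for \<open>H\<close> whose only edge is \<open>e\<close>; all conditions ignore isolated vertices.\<close>

definition one_edge_type :: "'a coloured_ribbon_graph \<Rightarrow> 'a set \<Rightarrow> etype" where
  "one_edge_type H e =
     (if \<not> loop H e then
        (if \<exists>C\<in>vclasses H. {v \<in> verts H. v \<inter> e \<noteq> {}} \<subseteq> C then Bp else Bs)
      else if orientable_loop H e then
        (if \<exists>C\<in>bclasses H. {f \<in> bdrys H. f \<inter> e \<noteq> {}} \<subseteq> C then Olh else Olc)
      else Nl)"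

text \<open>
  The other edges are contracted (deleted) one after the other; the outcome does not depend on
  the order.
\<close>

definition has_type :: "'a coloured_ribbon_graph \<Rightarrow> 'a set \<Rightarrow> etype \<times> etype \<Rightarrow> bool" where
  "has_type G e ij \<longleftrightarrow> (\<exists>es. distinct es \<and> set es = edges G - {e} \<and>
     ij = (one_edge_type (fold contract es G) e, one_edge_type (fold delete es G) e))"


section \<open>Polynomials with fractional exponents\<close>

text \<open>
  \<open>'i fpoly\<close> is the ring of finite integer combinations of monomials in the indeterminates \<open>'i\<close> with
  rational (possibly negative) exponents, that is, the integral group ring of \<open>'i \<Rightarrow>\<^sub>0 rat\<close>.
\<close>

type_synonym 'i fpoly = "('i \<Rightarrow>\<^sub>0 rat) \<Rightarrow>\<^sub>0 int"

definition monomial :: "('i \<Rightarrow>\<^sub>0 rat) \<Rightarrow> 'i fpoly" where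
  "monomial m = Poly_Mapping.single m 1"

definition var :: "'i \<Rightarrow> 'i fpoly" where
  "var i = monomial (Poly_Mapping.single i 1)"

text \<open>The power \<open>p\<^sup>q\<close> of a monomial \<open>p\<close>; unspecified if \<open>p\<close> is not a monomial with coefficient \<open>1\<close>.\<close>

definition mpow :: "'i fpoly \<Rightarrow> rat \<Rightarrow> 'i fpoly" (infixr "\<up>" 80) where
  "p \<up> q = monomial (Poly_Mapping.map (\<lambda>c. q * c) (THE m. p = monomial m))"

definition mdiv :: "'i fpoly \<Rightarrow> 'i fpoly \<Rightarrow> 'i fpoly" (infixl "\<oslash>" 70) where
  "p \<oslash> q = p * q \<up> (-1)"

definition r1 :: "'a coloured_ribbon_graph \<Rightarrow> 'a set set \<Rightarrow> rat" where
  "r1 G A = mrank (vgraph G) A"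

definition r2 :: "'a coloured_ribbon_graph \<Rightarrow> 'a set set \<Rightarrow> rat" where
  "r2 G A = rho G A - mrank (vgraph G) A"

definition r3 :: "'a coloured_ribbon_graph \<Rightarrow> 'a set set \<Rightarrow> rat" where
  "r3 G A = mrank (bgraph G) (edges G) - mrank (bgraph G) (edges G - A)"

definition r4 :: "'a coloured_ribbon_graph \<Rightarrow> 'a set set \<Rightarrow> rat" where
  "r4 G A = of_nat (card A) + mrank (bgraph G) (edges G - A) - mrank (bgraph G) (edges G) - rho G A"

text \<open>
  As exponents may be fractional, the Tutte polynomial is evaluated at monomials \<open>w\<close>, \<open>x\<close>, \<open>y\<close>, \<open>z\<close> only;
  the polynomial itself is the case where these are four indeterminates.
\<close>

definition T_ps :: "'a coloured_ribbon_graph \<Rightarrow> 'i fpoly \<Rightarrow> 'i fpoly \<Rightarrow> 'i fpoly \<Rightarrow> 'i fpoly \<Rightarrow> 'i fpoly" where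
  "T_ps G w x y z = (\<Sum>A\<in>Pow (edges G).
     w \<up> (r1 G (edges G) - r1 G A) * x \<up> (r2 G (edges G) - r2 G A) * y \<up> r3 G A * z \<up> r4 G A)"


section \<open>The coefficient ring and the recursion\<close>

datatype indet = I_alpha | I_beta | I_gamma
  | I_a_bs | I_a_bp | I_a_olc | I_a_olh
  | I_b_bs | I_b_bp | I_b_olc | I_b_olh

definition half_exponents :: "indet set" where
  "half_exponents = {I_a_bp, I_a_olh, I_b_bp, I_b_olh}"

text \<open>
  The polynomial ring over \<open>\<int>\<close> in the eleven indeterminates, where those in \<open>half_exponents\<close> are
  replaced by their square roots.
\<close>

definition coeff_ring :: "indet fpoly set" where
  "coeff_ring = {p. \<forall>m\<in>Poly_Mapping.keys p. \<forall>i.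
     (if i \<in> half_exponents then 2 * Poly_Mapping.lookup m i else Poly_Mapping.lookup m i) \<in> \<nat>}"

abbreviation \<alpha> :: "indet fpoly" where "\<alpha> \<equiv> var I_alpha"
abbreviation \<beta> :: "indet fpoly" where "\<beta> \<equiv> var I_beta"
abbreviation \<gamma> :: "indet fpoly" where "\<gamma> \<equiv> var I_gamma"

fun acoef :: "etype \<Rightarrow> indet fpoly" where
  "acoef Bs = var I_a_bs"
| "acoef Bp = var I_a_bp"
| "acoef Olc = var I_a_olc"
| "acoef Olh = var I_a_olh"
| "acoef Nl = var I_a_bp \<up> (1/2) * var I_a_olh \<up> (1/2)"

fun bcoef :: "etype \<Rightarrow> indet fpoly" where
  "bcoef Bs = var I_b_bs"
| "bcoef Bp = var I_b_bp"
| "bcoef Olc = var I_b_olc"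
| "bcoef Olh = var I_b_olh"
| "bcoef Nl = var I_b_bp \<up> (1/2) * var I_b_olh \<up> (1/2)"

definition satisfies_recursion ::
    "'a coloured_ribbon_graph set \<Rightarrow> ('a coloured_ribbon_graph \<Rightarrow> indet fpoly) \<Rightarrow> bool" where
  "satisfies_recursion \<G> U \<longleftrightarrow> (\<forall>G\<in>\<G>.
     (\<forall>e\<in>edges G. \<forall>i j. has_type G e (i, j) \<longrightarrow>
        U G = acoef i * U (delete e G) + bcoef j * U (contract e G)) \<and>
     (edges G = {} \<longrightarrow>
        U G = \<alpha> ^ card (vclasses G) * \<beta> ^ card (bclasses G) * \<gamma> ^ card (verts G)))"

end

(*
  Expanding T_ps turns the right-hand side into a sum over A of monomials whose exponents are affine
  in k(A) for G/V, k(E - A) for G*/B and b(A). Deleting or contracting e changes these three counts in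
  a simple way: on the level of points, merging the colour classes at e amounts to adding e x e to the
  equivalence relation "same colour". Hence the sum satisfies the recursion as soon as the type of e is
  known to record how the three counts change when e is added to E - e (for the a-coefficient) or to
  the empty set (for the b-coefficient). This is a statement about graphs with a single edge, where the
  walks leaving the four corners of the ribbon pair up these corners, in one of three ways.
  Uniqueness and integrality follow from the recursion by induction on the number of edges.
*)
theory Submission
  imports Defs
begin

section \<open>Counting equivalence classes\<close>

text \<open>The factor contributed by \<open>e\<close> has to be the same for every
  \<open>A\<close>. For \<open>A\<close> avoiding \<open>e\<close>, the counts that G attaches to
  \<open>A\<close> are those that the deletion attaches to \<open>A\<close>, and the counts that G
  attaches to \<open>insert e A\<close> are those that the contraction attaches to \<open>A\<close>.
  Only the reference values at the empty set and at E, which normalise the four ranks, are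
  displaced. This displacement does not involve \<open>A\<close>, and a one-edge minor shows all of
  it. A non-orientable loop contributes 1/2 to each of the second and the fourth rank; this is the
  origin of the square roots in the \<open>Nl\<close> coefficients. The obstacle is that vertices,
  boundary components and colour classes are nested sets that change under minors. The set of points
  does not change. So each component count of the two colour graphs is written as the number of
  values of a function on the points, and two such numbers are compared through the kernels of the
  functions. Since the state sum is an explicit candidate, existence needs no check that different
  orders of eliminating edges agree.\<close>

lemma card_image_eq_kernel:
  assumes "\<And>x y. x \<in> P \<Longrightarrow> y \<in> P \<Longrightarrow> f x = f y \<longleftrightarrow> g x = g y"
  shows "card (f ` P) = card (g ` P)"
proof -
  define h where "h = (\<lambda>u. g (inv_into P f u))"
  have h: "h (f x) = g x" if "x \<in> P" for x
    using assms[OF inv_into_into[of "f x" f P] that] f_inv_into_f[of "f x" f P] that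
    by (auto simp: h_def)
  have "g ` P = h ` (f ` P)"
    using h by (auto simp: image_image)
  moreover have "inj_on h (f ` P)"
    using h assms by (auto simp: inj_on_def)
  ultimately show ?thesis by (simp add: card_image)
qed

lemma card_image_merge:
  assumes "finite P" "u \<in> P" "w \<in> P" "f u \<noteq> f w"
    and "\<And>x y. x \<in> P \<Longrightarrow> y \<in> P \<Longrightarrow>
      g x = g y \<longleftrightarrow> f x = f y \<or> f x \<in> {f u, f w} \<and> f y \<in> {f u, f w}"
  shows "card (f ` P) = Suc (card (g ` P))"
proof -
  \<comment> \<open>\<open>h\<close> renames the value \<open>f w\<close> to \<open>f u\<close>: it
    has the kernel of \<open>g\<close>, and exactly one value fewer than \<open>f\<close>.\<close>
  define h where "h = (\<lambda>x. if f x = f w then f u else f x)"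
  have "card (g ` P) = card (h ` P)"
    by (rule card_image_eq_kernel) (use assms(4,5) in \<open>auto simp: h_def\<close>)
  moreover have "h ` P = f ` P - {f w}"
    using assms(2,4) by (auto simp: h_def)
  ultimately show ?thesis
    using card_Suc_Diff1[of "f ` P" "f w"] assms(1,3) by simp
qed

lemma quotient_image: "P // r = (\<lambda>x. r `` {x}) ` P"
  by (auto simp: quotient_def)

lemma rtrancl_class_eq_iff:
  assumes "sym r"
  shows "r\<^sup>* `` {x} = r\<^sup>* `` {y} \<longleftrightarrow> (x, y) \<in> r\<^sup>*"
  using sym_rtrancl[OF assms] by (auto dest: symD intro: rtrancl_trans)

section \<open>Orbits of two pairings\<close>

definition orel :: "'a set \<Rightarrow> ('a \<Rightarrow> 'a) \<Rightarrow> ('a \<Rightarrow> 'a) \<Rightarrow> ('a \<times> 'a) set" where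
  "orel P f g = {(p, f p) |p. p \<in> P} \<union> {(p, g p) |p. p \<in> P}"

lemma orbits_image: "orbits P f g = (\<lambda>x. (orel P f g)\<^sup>* `` {x}) ` P"
  by (simp add: orbits_def orel_def quotient_image)

lemma pairing_onD:
  assumes "pairing_on P f" "p \<in> P"
  shows "f p \<in> P" "f p \<noteq> p" "f (f p) = p"
  using assms by (auto simp: pairing_on_def)

lemma pairing_on_eq_iff:
  assumes "pairing_on P f" "p \<in> P" "q \<in> P"
  shows "f p = f q \<longleftrightarrow> p = q"
  using pairing_onD(3)[OF assms(1)] assms(2,3) by metis

text \<open>Deletion and contraction replace one step map by another on the corners of an edge. The
  result is again an involution because both maps preserve that set, so no step crosses its
  border.\<close>

lemma pairing_on_switch:
  assumes "pairing_on P f" "pairing_on P g" "\<And>p. p \<in> D \<Longrightarrow> p \<in> P \<Longrightarrow> f p \<in> D \<and> g p \<in> D"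
  shows "pairing_on P (\<lambda>p. if p \<in> D then f p else g p)"
  unfolding pairing_on_def
proof (intro ballI conjI)
  fix p assume p: "p \<in> P"
  note f = pairing_onD[OF assms(1) p] and g = pairing_onD[OF assms(2) p]
  show "(if p \<in> D then f p else g p) \<in> P" "(if p \<in> D then f p else g p) \<noteq> p"
    using f g by auto
  have "g p \<notin> D" if "p \<notin> D"
    using assms(3)[of "g p"] g that by auto
  then show "(if (if p \<in> D then f p else g p) \<in> D then f (if p \<in> D then f p else g p)
      else g (if p \<in> D then f p else g p)) = p"
    using f g assms(3) p by auto
qed

lemma sym_orel:
  assumes "pairing_on P f" "pairing_on P g"
  shows "sym (orel P f g)"
proof (rule symI)
  fix a b assume "(a, b) \<in> orel P f g"
  then consider "a \<in> P" "b = f a" | "a \<in> P" "b = g a" by (auto simp: orel_def)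
  then show "(b, a) \<in> orel P f g"
    by cases (use pairing_onD[OF assms(1)] pairing_onD[OF assms(2)] in \<open>force simp: orel_def\<close>)+
qed

lemma orbit_subset:
  assumes "x \<in> D" "\<And>y. y \<in> D \<Longrightarrow> y \<in> P \<Longrightarrow> f y \<in> D" "\<And>y. y \<in> D \<Longrightarrow> y \<in> P \<Longrightarrow> g y \<in> D"
  shows "(orel P f g)\<^sup>* `` {x} \<subseteq> D"
proof -
  have "y \<in> D" if "(x, y) \<in> (orel P f g)\<^sup>*" for y
    using that by induction (use assms in \<open>auto simp: orel_def\<close>)
  then show ?thesis by auto
qed

lemma orbit_closed:
  assumes "y \<in> (orel P f g)\<^sup>* `` {x}" "y \<in> P"
  shows "f y \<in> (orel P f g)\<^sup>* `` {x}" "g y \<in> (orel P f g)\<^sup>* `` {x}"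
  using assms by (auto simp: orel_def intro: rtrancl_into_rtrancl)

lemma partition_on_orbits:
  assumes "pairing_on P f" "pairing_on P g"
  shows "partition_on P (orbits P f g)"
proof -
  have sub: "(orel P f g)\<^sup>* `` {x} \<subseteq> P" if "x \<in> P" for x
    using that assms by (intro orbit_subset) (auto dest: pairing_onD)
  have "disjnt c d" if "c \<in> orbits P f g" "d \<in> orbits P f g" "c \<noteq> d" for c d
  proof -
    obtain x y where xy: "c = (orel P f g)\<^sup>* `` {x}" "d = (orel P f g)\<^sup>* `` {y}"
      using \<open>c \<in> _\<close> \<open>d \<in> _\<close> unfolding orbits_image by blast
    have "c = d" if "z \<in> c" "z \<in> d" for z
      using that unfolding xy
      by (metis Image_singleton_iff rtrancl_class_eq_iff sym_orel[OF assms])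
    then show ?thesis using \<open>c \<noteq> d\<close> by (auto simp: disjnt_def)
  qed
  then show ?thesis
    using sub by (intro partition_onI) (unfold orbits_image, blast+)
qed

lemma orbits_cong:
  assumes "\<And>p. p \<in> P \<Longrightarrow> f p = f' p" "\<And>p. p \<in> P \<Longrightarrow> g p = g' p"
  shows "orbits P f g = orbits P f' g'"
proof -
  have "orel P f g = orel P f' g'" using assms by (force simp: orel_def)
  then show ?thesis by (simp add: orbits_image)
qed

text \<open>An orbit that avoids \<open>e\<close> never takes a step at which the two maps differ.
  Hence vertices and boundary components away from an edge survive its contraction or
  deletion.\<close>

lemma untouched_orbits_eq:
  assumes "\<And>p. p \<in> P \<Longrightarrow> p \<notin> e \<Longrightarrow> g p = g' p"
  shows "{c \<in> orbits P f g. c \<inter> e = {}} = {c \<in> orbits P f g'. c \<inter> e = {}}"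
proof -
  have *: "(orel P f h)\<^sup>* `` {x} = (orel P f h')\<^sup>* `` {x}"
    if e: "(orel P f h)\<^sup>* `` {x} \<inter> e = {}" and h: "\<And>p. p \<in> P \<Longrightarrow> p \<notin> e \<Longrightarrow> h p = h' p"
    for x and h h' :: "'a \<Rightarrow> 'a"
  proof
    \<comment> \<open>Only the orbit under \<open>h\<close> is known to avoid \<open>e\<close>. For
      a walk under \<open>h'\<close> the induction hypothesis places \<open>y\<close> in that orbit
      first.\<close>
    have "(x, y) \<in> (orel P f h)\<^sup>*" if "(x, y) \<in> (orel P f h')\<^sup>*" for y
      using that
    proof induction
      case (step y z)
      then have "y \<notin> e" using e by auto
      then have "(y, z) \<in> orel P f h" using step(2) h by (auto simp: orel_def)
      then show ?case using step by auto
    qed auto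
    then show "(orel P f h')\<^sup>* `` {x} \<subseteq> (orel P f h)\<^sup>* `` {x}" by auto
    have "(x, y) \<in> (orel P f h')\<^sup>*" if "(x, y) \<in> (orel P f h)\<^sup>*" for y
      using that
    proof induction
      case (step y z)
      then have "y \<notin> e" using e by auto
      then have "(y, z) \<in> orel P f h'" using step(2) h by (auto simp: orel_def)
      then show ?case using step by auto
    qed auto
    then show "(orel P f h)\<^sup>* `` {x} \<subseteq> (orel P f h')\<^sup>* `` {x}" by auto
  qed
  have "{c \<in> orbits P f h. c \<inter> e = {}} \<subseteq> {c \<in> orbits P f h'. c \<inter> e = {}}"
    if h: "\<And>p. p \<in> P \<Longrightarrow> p \<notin> e \<Longrightarrow> h p = h' p" for h h' :: "'a \<Rightarrow> 'a"
  proof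
    fix c assume "c \<in> {c \<in> orbits P f h. c \<inter> e = {}}"
    then obtain x where "x \<in> P" "c = (orel P f h)\<^sup>* `` {x}" "c \<inter> e = {}"
      by (auto simp: orbits_image)
    then show "c \<in> {c \<in> orbits P f h'. c \<inter> e = {}}"
      using *[of h x h'] h by (auto simp: orbits_image)
  qed
  from this[of g g'] this[of g' g] show ?thesis using assms by auto
qed

section \<open>Alternating walks\<close>

text \<open>A reflection in the dihedral group generated by two fixed-point free involutions is conjugate
  to one of them.\<close>

lemma reflection_no_fixed_point:
  assumes "pairing_on P f" "pairing_on P g" "p \<in> P"
  shows "f (((\<lambda>x. g (f x)) ^^ k) p) \<noteq> p"
  using \<open>p \<in> P\<close>
proof (induction k arbitrary: p rule: less_induct)
  case (less k)
  note D = pairing_onD[OF assms(1)] pairing_onD[OF assms(2)]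
  define \<phi> where "\<phi> = (\<lambda>x. g (f x))"
  have P: "(\<phi> ^^ n) q \<in> P" if "q \<in> P" for n q
    using that by (induction n) (auto simp: \<phi>_def D)
  consider "k = 0" | "k = 1" | m where "k = Suc (Suc m)"
    by (metis One_nat_def not0_implies_Suc)
  then show ?case
  proof cases
    case 1 then show ?thesis using D less.prems by auto
  next
    \<comment> \<open>A fixed point would give \<open>g (f p) = f p\<close>.\<close>
    case 2
    have "f (g (f p)) \<noteq> p"
      using D(3)[of "g (f p)"] D(5)[of "f p"] D(1)[OF less.prems] D(4)[of "f p"] by metis
    then show ?thesis using 2 by simp
  next
    \<comment> \<open>Conjugating by \<open>\<phi>\<close> shortens the reflection by two: a fixed
      point \<open>p\<close> for \<open>k\<close> yields the fixed point \<open>\<phi> p\<close> for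
      \<open>m = k - 2\<close>.\<close>
    case 3
    show ?thesis
    proof
      assume "f (((\<lambda>x. g (f x)) ^^ k) p) = p"
      moreover have "(\<phi> ^^ k) p = \<phi> ((\<phi> ^^ m) (\<phi> p))"
        unfolding 3 by (simp add: funpow_swap1)
      ultimately have "f (g (f ((\<phi> ^^ m) (\<phi> p)))) = p"
        by (simp add: \<phi>_def)
      then have "f ((\<phi> ^^ m) (\<phi> p)) = \<phi> p"
        using D P[of "\<phi> p" m] less.prems by (metis \<phi>_def)
      then show False
        using less.IH[of m "\<phi> p"] 3 P[of p 1] less.prems by (auto simp: \<phi>_def)
    qed
  qed
qed

text \<open>By finiteness two iterates coincide, and injectivity of both pairings cancels the common
  initial part. \<open>Suc n\<close> keeps the period positive.\<close>

lemma rotation_period: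
  assumes "finite P" "pairing_on P f" "pairing_on P g" "p \<in> P"
  obtains n where "((\<lambda>x. g (f x)) ^^ Suc n) p = p"
proof -
  note D = pairing_onD[OF assms(2)] pairing_onD[OF assms(3)]
  define \<phi> where "\<phi> = (\<lambda>x. g (f x))"
  have P: "(\<phi> ^^ n) p \<in> P" for n
    using assms(4) by (induction n) (auto simp: \<phi>_def D)
  have "\<not> inj (\<lambda>n. (\<phi> ^^ n) p)"
    using finite_subset[of "range (\<lambda>n. (\<phi> ^^ n) p)" P] P assms(1) finite_imageD[of "\<lambda>n. (\<phi> ^^ n) p" UNIV]
    by (auto simp: image_subset_iff)
  then obtain i j where ij: "i < j" "(\<phi> ^^ i) p = (\<phi> ^^ j) p"
    by (metis (mono_tags, lifting) linorder_injI)
  have "(\<phi> ^^ i) p = (\<phi> ^^ (i + Suc n)) p \<Longrightarrow> (\<phi> ^^ Suc n) p = p" for n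
  proof (induction i)
    case (Suc i)
    have "g (f ((\<phi> ^^ i) p)) = g (f ((\<phi> ^^ (i + Suc n)) p))"
      using Suc.prems by (simp add: \<phi>_def)
    then have "(\<phi> ^^ i) p = (\<phi> ^^ (i + Suc n)) p"
      using P pairing_on_eq_iff[OF assms(2)] pairing_on_eq_iff[OF assms(3)] D by metis
    then show ?case by (rule Suc.IH)
  qed simp
  moreover obtain n where "j = i + Suc n" using ij(1) less_iff_Suc_add by auto
  ultimately have "(\<phi> ^^ Suc n) p = p" using ij(2) by blast
  then show ?thesis by (rule that[folded \<phi>_def])
qed

text \<open>An orbit is a cycle of alternating \<open>f\<close>- and \<open>g\<close>-steps. One
  colour consists of the points reached from \<open>p\<close> by rotations, the other of their
  images under \<open>f\<close>; the two are disjoint because reflections have no fixed points. For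
  a vertex this is an orientation of its boundary circle.\<close>

lemma orbit_two_colouring:
  assumes "finite P" "pairing_on P f" "pairing_on P g" "p \<in> P"
  obtains S where "\<And>x. x \<in> (orel P f g)\<^sup>* `` {p} \<Longrightarrow> (f x \<in> S \<longleftrightarrow> x \<notin> S) \<and> (g x \<in> S \<longleftrightarrow> x \<notin> S)"
proof -
  note D = pairing_onD[OF assms(2)] pairing_onD[OF assms(3)]
  define \<phi> where "\<phi> = (\<lambda>x. g (f x))"
  define S where "S = range (\<lambda>k. (\<phi> ^^ k) p)"
  have P: "(\<phi> ^^ n) p \<in> P" for n
    using assms(4) by (induction n) (auto simp: \<phi>_def D)
  obtain n where n: "(\<phi> ^^ Suc n) p = p"
    using rotation_period[OF assms] unfolding \<phi>_def by blast
  \<comment> \<open>An equality here would make the reflection with \<open>m - k\<close> rotations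
    fix the point \<open>(\<phi> ^^ k) p\<close>. The case \<open>m < k\<close> follows by applying
    the involution \<open>f\<close>.\<close>
  have ne: "f ((\<phi> ^^ k) p) \<noteq> (\<phi> ^^ m) p" if "k \<le> m" for k m
  proof
    assume eq: "f ((\<phi> ^^ k) p) = (\<phi> ^^ m) p"
    have "(\<phi> ^^ m) p = (\<phi> ^^ (m - k)) ((\<phi> ^^ k) p)"
      using that by (simp flip: funpow_add comp_apply[of "\<phi> ^^ (m - k)" "\<phi> ^^ k"])
    then have "f ((\<phi> ^^ (m - k)) ((\<phi> ^^ k) p)) = (\<phi> ^^ k) p"
      using eq D P by metis
    then show False
      using reflection_no_fixed_point[OF assms(2,3) P[of k]] by (simp add: \<phi>_def)
  qed
  have "f ((\<phi> ^^ k) p) \<noteq> (\<phi> ^^ m) p" for k m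
    using ne[of k m] ne[of m k] D(3)[OF P[of k]] by (cases "k \<le> m") auto
  then have fS: "f x \<notin> S" if "x \<in> S" for x using that by (auto simp: S_def)
  have gf: "g (f x) \<in> S" if "x \<in> S" for x
  proof -
    obtain k where "x = (\<phi> ^^ k) p" using \<open>x \<in> S\<close> by (auto simp: S_def)
    then have "g (f x) = (\<phi> ^^ Suc k) p" by (simp add: \<phi>_def)
    then show ?thesis unfolding S_def by blast
  qed
  have gS: "g x \<in> f ` S" if "x \<in> S" for x
  proof -
    obtain k where k: "x = (\<phi> ^^ k) p" using \<open>x \<in> S\<close> by (auto simp: S_def)
    \<comment> \<open>A predecessor under the rotation is needed; for \<open>p\<close> itself it is
      supplied by the period.\<close>
    obtain j where "x = (\<phi> ^^ Suc j) p"
    proof (cases k)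
      case 0
      then have "x = (\<phi> ^^ Suc n) p" using k n by simp
      then show ?thesis by (rule that)
    qed (use k that in blast)
    then have "x = g (f ((\<phi> ^^ j) p))" by (simp add: \<phi>_def)
    then have "g x = f ((\<phi> ^^ j) p)" using D(6)[OF D(1)[OF P[of j]]] by simp
    then show ?thesis unfolding S_def by blast
  qed
  have SP: "S \<subseteq> P" using P by (auto simp: S_def)
  have "p = (\<phi> ^^ 0) p" by simp
  then have "p \<in> S" unfolding S_def by blast
  have ffS: "f (f x) = x" if "x \<in> S" for x using D(3) SP that by blast
  have "f x \<in> S \<union> f ` S" "g x \<in> S \<union> f ` S" if "x \<in> S \<union> f ` S" for x
    using that gf gS ffS by auto
  with \<open>p \<in> S\<close> have "(orel P f g)\<^sup>* `` {p} \<subseteq> S \<union> f ` S"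
    by (intro orbit_subset) auto
  moreover have "(f x \<in> S \<longleftrightarrow> x \<notin> S) \<and> (g x \<in> S \<longleftrightarrow> x \<notin> S)" if "x \<in> S \<union> f ` S" for x
  proof (cases "x \<in> S")
    case True
    then show ?thesis using fS gS[OF True] by auto
  next
    case False
    with that obtain y where "y \<in> S" "x = f y" by auto
    then show ?thesis using fS ffS gf by auto
  qed
  ultimately show ?thesis by (intro that[of S]) blast
qed

text \<open>Removing the \<open>g\<close>-steps at \<open>e\<close> cuts the orbits that meet \<open>e\<close> into paths whose end points lie in \<open>e\<close>.
  Here \<open>C\<close> is the path from \<open>p\<close> to \<open>x\<close>.\<close>

lemma alternating_path:
  assumes "finite P" "pairing_on P f" "pairing_on P g" "e \<subseteq> P" "\<And>y. y \<in> e \<Longrightarrow> g y \<in> e" "p \<in> e"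
  obtains x C where "x \<in> e" "x \<noteq> p" "C \<subseteq> P" "C \<inter> e = {p, x}"
    "\<And>y. y \<in> C \<Longrightarrow> f y \<in> C" "\<And>y. y \<in> C \<Longrightarrow> y \<notin> e \<Longrightarrow> g y \<in> C"
    "\<And>S. \<forall>y\<in>C. f y \<in> S \<longleftrightarrow> y \<notin> S \<Longrightarrow> \<forall>y\<in>C - e. g y \<in> S \<longleftrightarrow> y \<notin> S \<Longrightarrow> x \<in> S \<longleftrightarrow> p \<notin> S"
    "\<And>D. p \<in> D \<Longrightarrow> \<forall>y\<in>D \<inter> P. f y \<in> D \<Longrightarrow> \<forall>y\<in>D \<inter> P - e. g y \<in> D \<Longrightarrow> C \<subseteq> D"
proof -
  note D = pairing_onD[OF assms(2)] pairing_onD[OF assms(3)]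
  have p: "p \<in> P" using assms by auto
  \<comment> \<open>The walk from \<open>p\<close> is
    \<open>w 0, f (w 0), w 1, f (w 1), ...\<close>, with an \<open>f\<close>-step inside each pair
    and a \<open>g\<close>-step between pairs.\<close>
  define w where "w k = ((\<lambda>x. g (f x)) ^^ k) p" for k
  have w0: "w 0 = p" and wS: "w (Suc k) = g (f (w k))" for k by (auto simp: w_def)
  have wP: "w k \<in> P" for k by (induction k) (auto simp: w0 wS p D)
  obtain n where "w (Suc n) = p"
    using rotation_period[OF assms(1-3) p] unfolding w_def by blast
  then have "g (f (w n)) = p" by (simp add: wS)
  then have "f (w n) = g p" using D wP by metis
  \<comment> \<open>A full period arrives at \<open>g p\<close>, which is in \<open>e\<close>, so
    the walk certainly comes back to \<open>e\<close>.\<close>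
  then have ex: "\<exists>k. f (w k) \<in> e" using assms(5)[OF assms(6)] by (intro exI[of _ n]) simp
  \<comment> \<open>The first \<open>f\<close>-step that lands in \<open>e\<close>: the path stops
    there, just before a removed \<open>g\<close>-step.\<close>
  define k where "k = (LEAST k. f (w k) \<in> e)"
  have k: "f (w k) \<in> e" unfolding k_def using ex by (rule LeastI_ex)
  have ke: "f (w i) \<notin> e" if "i < k" for i using that unfolding k_def by (rule not_less_Least)
  have fP: "f (w i) \<in> P" and ff: "f (f (w i)) = w i" and gw: "g (w (Suc i)) = f (w i)" for i
    using D(1,3)[OF wP] D(6)[OF D(1)[OF wP]] wS by auto
  have we: "w (Suc i) \<notin> e" if "i < k" for i
    using ke[OF that] assms(5)[of "w (Suc i)"] unfolding gw by blast
  define C where "C = w ` {..k} \<union> (\<lambda>i. f (w i)) ` {..k}"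
  show ?thesis
  proof (rule that[of "f (w k)" C])
    show "f (w k) \<in> e" by (rule k)
    show "f (w k) \<noteq> p"
      unfolding w_def by (rule reflection_no_fixed_point[OF assms(2,3) p])
    show "C \<subseteq> P" using wP fP by (auto simp: C_def)
    show "C \<inter> e = {p, f (w k)}"
    proof
      have "w i = p" if "i \<le> k" "w i \<in> e" for i using that we[of "i - 1"] w0 by (cases i) auto
      moreover have "i = k" if "i \<le> k" "f (w i) \<in> e" for i using that ke[of i] by linarith
      ultimately show "C \<inter> e \<subseteq> {p, f (w k)}" by (auto simp: C_def)
      show "{p, f (w k)} \<subseteq> C \<inter> e" using k assms(6) w0 by (auto simp: C_def intro: image_eqI[of _ _ 0])
    qed
    show "f y \<in> C" if "y \<in> C" for y using that ff by (auto simp: C_def)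
    show "g y \<in> C" if y: "y \<in> C" "y \<notin> e" for y
    proof -
      from y(1) consider i where "i \<le> k" "y = w i" | i where "i \<le> k" "y = f (w i)"
        by (auto simp: C_def)
      then show ?thesis
      proof cases
        case 1
        with y(2) w0 assms(6) obtain j where "i = Suc j" by (cases i) auto
        with 1 have "g y = f (w j)" "j \<le> k" using gw by auto
        then show ?thesis by (auto simp: C_def)
      next
        case 2
        with k y(2) have "i \<noteq> k" by auto
        with 2 have "g y = w (Suc i)" "Suc i \<le> k" by (auto simp: wS)
        then show ?thesis unfolding C_def by blast
      qed
    qed
    fix S assume S: "\<forall>y\<in>C. f y \<in> S \<longleftrightarrow> y \<notin> S" "\<forall>y\<in>C - e. g y \<in> S \<longleftrightarrow> y \<notin> S"
    \<comment> \<open>Each step flips membership in \<open>S\<close>, and \<open>w i\<close> is an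
      even number of steps away from \<open>p\<close>; the last \<open>f\<close>-step makes the
      number odd.\<close>
    have "w i \<in> S \<longleftrightarrow> p \<in> S" if "i \<le> k" for i
      using that
    proof (induction i)
      case (Suc i)
      then have "w i \<in> C" "f (w i) \<in> C - e" using ke[of i] by (auto simp: C_def)
      then show ?case using S Suc by (simp add: wS)
    qed (simp add: w0)
    then show "f (w k) \<in> S \<longleftrightarrow> p \<notin> S" using S by (auto simp: C_def)
  next
    fix D assume D': "p \<in> D" "\<forall>y\<in>D \<inter> P. f y \<in> D" "\<forall>y\<in>D \<inter> P - e. g y \<in> D"
    have "w i \<in> D" if "i \<le> k" for i
      using that
    proof (induction i)
      case (Suc i)
      then have "w i \<in> D \<inter> P" "f (w i) \<notin> e" "f (w i) \<in> P" using ke[of i] wP fP by auto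
      then show ?case using D' by (simp add: wS)
    qed (simp add: w0 D')
    then show "C \<subseteq> D" using D' wP by (auto simp: C_def)
  qed
qed

section \<open>Corners of an edge\<close>

definition touching :: "'a set set \<Rightarrow> 'a set \<Rightarrow> 'a set set" where
  "touching S e = {c \<in> S. c \<inter> e \<noteq> {}}"

lemma touching_orbits:
  assumes "pairing_on P f" "pairing_on P g" "e \<subseteq> P"
  shows "touching (orbits P f g) e = (\<lambda>x. (orel P f g)\<^sup>* `` {x}) ` e"
proof
  show "(\<lambda>x. (orel P f g)\<^sup>* `` {x}) ` e \<subseteq> touching (orbits P f g) e"
    using assms(3) by (auto simp: touching_def orbits_image)
  show "touching (orbits P f g) e \<subseteq> (\<lambda>x. (orel P f g)\<^sup>* `` {x}) ` e"
  proof
    fix c assume "c \<in> touching (orbits P f g) e"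
    then obtain x y where "c = (orel P f g)\<^sup>* `` {x}" "y \<in> c" "y \<in> e"
      by (auto simp: touching_def orbits_image)
    then show "c \<in> (\<lambda>x. (orel P f g)\<^sup>* `` {x}) ` e"
      using rtrancl_class_eq_iff[OF sym_orel[OF assms(1,2)], of x y] by auto
  qed
qed

text \<open>The orbits that miss \<open>e\<close> are common to both maps, so the counts differ only
  in the orbits that meet \<open>e\<close>. The additive form avoids subtraction of natural
  numbers.\<close>

lemma card_orbits_touching:
  assumes "finite P" "\<And>p. p \<in> P \<Longrightarrow> p \<notin> e \<Longrightarrow> g p = g' p"
  shows "card (orbits P f g) + card (touching (orbits P f g') e)
    = card (orbits P f g') + card (touching (orbits P f g) e)"
proof -
  have split: "card (orbits P f h) = card {c \<in> orbits P f h. c \<inter> e = {}} + card (touching (orbits P f h) e)" for h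
    unfolding touching_def
    by (subst card_Un_disjoint[symmetric])
      (use assms(1) in \<open>auto simp: orbits_image intro!: arg_cong[where f = card]\<close>)
  show ?thesis
    using split[of g] split[of g'] untouched_orbits_eq[of P e g g' f, OF assms(2)] by simp
qed

text \<open>The maps \<open>f\<close>, \<open>g\<close>, \<open>h\<close> stand for
  \<open>arc\<close>, \<open>vstep\<close>, \<open>bstep\<close> of a graph whose only edge has the
  corner \<open>p\<close>. Stated for bare maps, the assumptions are symmetric in \<open>g\<close>
  and \<open>h\<close>.\<close>

locale one_edge =
  fixes P :: "'a set" and f g h :: "'a \<Rightarrow> 'a" and p :: 'a
  assumes fin: "finite P"
    and f: "pairing_on P f" and g: "pairing_on P g" and h: "pairing_on P h"
    and p: "p \<in> P" and ne: "g p \<noteq> h p" and comm: "g (h p) = h (g p)"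
    and off: "\<And>y. y \<in> P \<Longrightarrow> y \<notin> {p, g p, h p, g (h p)} \<Longrightarrow> g y = h y"
begin

abbreviation "e \<equiv> {p, g p, h p, g (h p)}"
abbreviation "vs \<equiv> touching (orbits P f g) e"
abbreviation "bs \<equiv> touching (orbits P f h) e"

lemma corners:
  "e \<subseteq> P" "p \<noteq> g p" "p \<noteq> h p" "p \<noteq> g (h p)" "g p \<noteq> h p" "g p \<noteq> g (h p)" "h p \<noteq> g (h p)"
  "g (g p) = p" "h (h p) = p" "g (g (h p)) = h p" "h (g (h p)) = g p" "h (g p) = g (h p)"
proof -
  note g' = pairing_onD[OF g] and h' = pairing_onD[OF h]
  have P: "g p \<in> P" "h p \<in> P" "g (h p) \<in> P" using g'(1) h'(1) p by auto
  then show "e \<subseteq> P" using p by simp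
  show inv: "g (g p) = p" "h (h p) = p" "g (g (h p)) = h p" "h (g p) = g (h p)"
    by (rule g'(3)[OF p] h'(3)[OF p] g'(3)[OF P(2)] comm[symmetric])+
  then show "h (g (h p)) = g p" using h'(3)[OF P(1)] by simp
  show d: "p \<noteq> g p" "p \<noteq> h p" "g p \<noteq> h p" "h p \<noteq> g (h p)"
    using g'(2)[OF p] h'(2)[OF p] ne g'(2)[OF P(2)] by metis+
  show "p \<noteq> g (h p)" using inv(3) d(3) by auto
  show "g p \<noteq> g (h p)" using inv(1,3) d(2) by metis
qed

text \<open>Geometric duality: exchanging \<open>g\<close> and \<open>h\<close> exchanges vertices
  with boundary components and ends of the ribbon with its sides.\<close>

lemma swap: "one_edge P f h g p"
proof
  show "h y = g y" if "y \<in> P" "y \<notin> {p, h p, g p, h (g p)}" for y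
    using off[OF that(1)] that(2) corners(12) by auto
qed (rule fin f g h p ne[symmetric] comm[symmetric])+

lemma e_swap: "{p, h p, g p, h (g p)} = e"
  unfolding comm by auto

lemma closed: "y \<in> e \<Longrightarrow> g y \<in> e" "y \<in> e \<Longrightarrow> h y \<in> e"
  using corners by auto

lemmas vs_eq = touching_orbits[OF f g corners(1)]
lemmas bs_eq = touching_orbits[OF f h corners(1)]

lemma vclass_eq: "(orel P f g)\<^sup>* `` {x} = (orel P f g)\<^sup>* `` {y} \<longleftrightarrow> (x, y) \<in> (orel P f g)\<^sup>*"
  by (rule rtrancl_class_eq_iff[OF sym_orel[OF f g]])

lemma bclass_eq: "(orel P f h)\<^sup>* `` {x} = (orel P f h)\<^sup>* `` {y} \<longleftrightarrow> (x, y) \<in> (orel P f h)\<^sup>*"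
  by (rule rtrancl_class_eq_iff[OF sym_orel[OF f h]])

lemma steps:
  "(p, g p) \<in> (orel P f g)\<^sup>*" "(h p, g (h p)) \<in> (orel P f g)\<^sup>*"
  "(p, h p) \<in> (orel P f h)\<^sup>*" "(g p, g (h p)) \<in> (orel P f h)\<^sup>*"
proof -
  have "g p \<in> P" "h p \<in> P" using corners(1) by auto
  then show "(p, g p) \<in> (orel P f g)\<^sup>*" "(h p, g (h p)) \<in> (orel P f g)\<^sup>*"
    "(p, h p) \<in> (orel P f h)\<^sup>*" "(g p, g (h p)) \<in> (orel P f h)\<^sup>*"
    using p corners(12) by (auto simp: orel_def)
qed

text \<open>The walk uses \<open>g\<close> only off \<open>e\<close>, where \<open>g\<close> and
  \<open>h\<close> agree. Hence one and the same path lies in a single vertex and in a single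
  boundary component.\<close>

lemma path:
  assumes "a \<in> e"
  obtains x C where "x \<in> e" "x \<noteq> a" "C \<subseteq> P" "C \<inter> e = {a, x}"
    "\<And>y. y \<in> C \<Longrightarrow> f y \<in> C" "\<And>y. y \<in> C \<Longrightarrow> y \<notin> e \<Longrightarrow> g y \<in> C"
    "\<And>S. \<forall>y\<in>(orel P f g)\<^sup>* `` {a}. (f y \<in> S \<longleftrightarrow> y \<notin> S) \<and> (g y \<in> S \<longleftrightarrow> y \<notin> S) \<Longrightarrow>
      x \<in> S \<longleftrightarrow> a \<notin> S"
    "(a, x) \<in> (orel P f g)\<^sup>*" "(a, x) \<in> (orel P f h)\<^sup>*"
proof (rule alternating_path[OF fin f g corners(1) closed(1) assms])
  fix x C
  assume *: "x \<in> e" "x \<noteq> a" "C \<subseteq> P" "C \<inter> e = {a, x}"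
    "\<And>y. y \<in> C \<Longrightarrow> f y \<in> C" "\<And>y. y \<in> C \<Longrightarrow> y \<notin> e \<Longrightarrow> g y \<in> C"
    and S: "\<And>S. \<forall>y\<in>C. f y \<in> S \<longleftrightarrow> y \<notin> S \<Longrightarrow> \<forall>y\<in>C - e. g y \<in> S \<longleftrightarrow> y \<notin> S \<Longrightarrow> x \<in> S \<longleftrightarrow> a \<notin> S"
    and D: "\<And>D. a \<in> D \<Longrightarrow> \<forall>y\<in>D \<inter> P. f y \<in> D \<Longrightarrow> \<forall>y\<in>D \<inter> P - e. g y \<in> D \<Longrightarrow> C \<subseteq> D"
  have vs: "C \<subseteq> (orel P f g)\<^sup>* `` {a}"
    by (rule D) (use orbit_closed[of _ P f g a] in auto)
  have "C \<subseteq> (orel P f h)\<^sup>* `` {a}"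
  proof (rule D)
    show "\<forall>y\<in>(orel P f h)\<^sup>* `` {a} \<inter> P - e. g y \<in> (orel P f h)\<^sup>* `` {a}"
    proof
      fix y assume y: "y \<in> (orel P f h)\<^sup>* `` {a} \<inter> P - e"
      then have "g y = h y" by (intro off) blast+
      then show "g y \<in> (orel P f h)\<^sup>* `` {a}" using y orbit_closed(2)[of y P f h a] by simp
    qed
  qed (use orbit_closed(1)[of _ P f h a] in auto)
  moreover have "x \<in> C" using *(4) by blast
  ultimately show thesis
    using that[OF *] S vs by blast
qed

text \<open>The closed set \<open>C\<close> separates the vertex at one end of the ribbon from the
  vertex at the other end. On the boundary, the two sides of the ribbon each join two corners, and
  the last assumption joins the sides to each other.\<close>

lemma two_vertices:
  assumes "p \<in> C" "h p \<notin> C" "\<And>y. y \<in> C \<Longrightarrow> f y \<in> C" "\<And>y. y \<in> C \<Longrightarrow> g y \<in> C"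
    "(p, g p) \<in> (orel P f h)\<^sup>*"
  shows "card vs = 2" "card bs = 1"
proof -
  have "(orel P f g)\<^sup>* `` {p} \<subseteq> C" using assms by (intro orbit_subset) auto
  then have "(p, h p) \<notin> (orel P f g)\<^sup>*" using assms(2) by auto
  then have "vs = {(orel P f g)\<^sup>* `` {p}, (orel P f g)\<^sup>* `` {h p}}"
    "(orel P f g)\<^sup>* `` {p} \<noteq> (orel P f g)\<^sup>* `` {h p}"
    unfolding vs_eq using steps[folded vclass_eq] vclass_eq by auto
  then show "card vs = 2" by simp
  have "bs = {(orel P f h)\<^sup>* `` {p}}"
    unfolding bs_eq using steps[folded bclass_eq] assms(5)[folded bclass_eq] by auto
  then show "card bs = 1" by simp
qed

text \<open>Walking away from the edge pairs up its four corners. The pairing decides the type: \<open>p\<close> goes with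
  \<open>g p\<close> (not a loop), with \<open>h p\<close> (orientable loop) or with the opposite corner \<open>g (h p)\<close>.\<close>

lemma corner_pairing_cases:
  obtains (sides) "card vs = 2" "card bs = 1"
  | (untwisted) "card vs = 1" "card bs = 2"
      "\<exists>S. (\<forall>y\<in>\<Union>vs. (f y \<in> S \<longleftrightarrow> y \<notin> S) \<and> (g y \<in> S \<longleftrightarrow> y \<notin> S)) \<and> (\<forall>y\<in>e. h y \<in> S \<longleftrightarrow> y \<notin> S)"
  | (twisted) "card vs = 1" "card bs = 1"
      "\<nexists>S. (\<forall>y\<in>\<Union>vs. (f y \<in> S \<longleftrightarrow> y \<notin> S) \<and> (g y \<in> S \<longleftrightarrow> y \<notin> S)) \<and> (\<forall>y\<in>e. h y \<in> S \<longleftrightarrow> y \<notin> S)"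
proof -
  note D = pairing_onD[OF f] pairing_onD[OF g] pairing_onD[OF h]
  obtain x C where x: "x \<in> e" "x \<noteq> p" and C: "C \<subseteq> P" "C \<inter> e = {p, x}"
    "\<And>y. y \<in> C \<Longrightarrow> f y \<in> C" "\<And>y. y \<in> C \<Longrightarrow> y \<notin> e \<Longrightarrow> g y \<in> C"
    and S: "\<And>S. \<forall>y\<in>(orel P f g)\<^sup>* `` {p}. (f y \<in> S \<longleftrightarrow> y \<notin> S) \<and> (g y \<in> S \<longleftrightarrow> y \<notin> S) \<Longrightarrow>
      x \<in> S \<longleftrightarrow> p \<notin> S"
    and px: "(p, x) \<in> (orel P f g)\<^sup>*" "(p, x) \<in> (orel P f h)\<^sup>*"
    by (rule path[of p]) auto
  consider "x = g p" | "x = h p" | "x = g (h p)" using x by auto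
  then show thesis
  proof cases
    case 1
    \<comment> \<open>Since the path ends at \<open>g p\<close>, even the removed
      \<open>g\<close>-steps at its end points stay inside it, and \<open>C\<close> contains the
      whole vertex.\<close>
    have gC: "g y \<in> C" if "y \<in> C" for y
    proof (cases "y \<in> e")
      case True
      then have "y = p \<or> y = g p" using that C(2) 1 by blast
      then show ?thesis using C(2) 1 corners(8) by auto
    qed (rule C(4)[OF that])
    have pC: "p \<in> C" using C(2) by blast
    have hpC: "h p \<notin> C" 
      using C(2)[unfolded 1] corners(3,5) by (metis IntI insertCI insertE singletonD)
    note two_vertices[OF pC hpC C(3) gC px(2)[unfolded 1]]
    then show thesis by (rule sides)
  next
    case 2
    have hC: "h y \<in> C" if "y \<in> C" for y
    proof (cases "y \<in> e")
      case True
      then have "y = p \<or> y = h p" using that C(2) 2 by blast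
      then show ?thesis using C(2) 2 corners(9) by auto
    next
      case False
      then have "h y = g y" using off[of y] C(1) that by auto
      then show ?thesis using C(4)[OF that False] by simp
    qed
    have pC: "p \<in> C" using C(2) by blast
    have gpC: "g p \<notin> C" 
      using C(2)[unfolded 2] corners(2,5) by (metis IntI insertCI insertE singletonD)
    \<comment> \<open>This is the non-loop situation of the dual: \<open>C\<close> is closed under
      \<open>h\<close> instead of \<open>g\<close>, so \<open>swap\<close> yields two boundary
      components and one vertex.\<close>
    note card = one_edge.two_vertices[OF swap pC gpC C(3) hC px(1)[unfolded 2], unfolded e_swap]
    obtain T where T: "\<And>y. y \<in> (orel P f g)\<^sup>* `` {p} \<Longrightarrow>
        (f y \<in> T \<longleftrightarrow> y \<notin> T) \<and> (g y \<in> T \<longleftrightarrow> y \<notin> T)"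
      using orbit_two_colouring[OF fin f g p] by blast
    have vs: "vs = {(orel P f g)\<^sup>* `` {p}}"
      unfolding vs_eq using steps[folded vclass_eq] px(1)[folded vclass_eq] 2 by auto
    \<comment> \<open>The walk gives \<open>p\<close> and \<open>h p\<close> opposite colours; the
      \<open>g\<close>-steps at these corners carry this over to the other side of the
      ribbon.\<close>
    have "h p \<in> T \<longleftrightarrow> p \<notin> T" using S[of T] T 2 by blast
    moreover have in_class: "p \<in> (orel P f g)\<^sup>* `` {p}" "h p \<in> (orel P f g)\<^sup>* `` {p}"
      using px(1) 2 by auto
    ultimately have "\<forall>y\<in>e. h y \<in> T \<longleftrightarrow> y \<notin> T"
      using T[OF in_class(1)] T[OF in_class(2)] corners by auto
    then show thesis
      using T by (intro untwisted card exI[of _ T]) (auto simp: vs)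
  next
    case 3
    have vs: "vs = {(orel P f g)\<^sup>* `` {p}}"
      unfolding vs_eq using steps[folded vclass_eq] px(1)[folded vclass_eq] 3 by auto
    then have "card vs = 1" by simp
    have "(orel P f h)\<^sup>* `` {g (h p)} = (orel P f h)\<^sup>* `` {p}"
      using px(2)[folded bclass_eq] 3 by simp
    then have "bs = {(orel P f h)\<^sup>* `` {p}}"
      unfolding bs_eq using steps[folded bclass_eq] by auto
    then have "card bs = 1" by simp
    \<comment> \<open>Both \<open>g (h p)\<close> (by the walk) and \<open>g p\<close> (by a
      \<open>g\<close>-step) have the colour opposite to \<open>p\<close>, yet a side of the ribbon
      joins them and demands different colours.\<close>
    moreover have False
      if T: "\<forall>y\<in>\<Union>vs. (f y \<in> T \<longleftrightarrow> y \<notin> T) \<and> (g y \<in> T \<longleftrightarrow> y \<notin> T)" "\<forall>y\<in>e. h y \<in> T \<longleftrightarrow> y \<notin> T" for T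
    proof -
      have "g (h p) \<in> T \<longleftrightarrow> p \<notin> T" using S[of T] T(1) 3 unfolding vs by blast
      moreover have "g p \<in> T \<longleftrightarrow> p \<notin> T" using T(1) unfolding vs by blast
      moreover have "g (h p) \<in> T \<longleftrightarrow> g p \<notin> T" using T(2) corners(12) by (metis insertCI)
      ultimately show False by blast
    qed
    ultimately show thesis using \<open>card vs = 1\<close> by (intro twisted) blast+
  qed
qed

end

section \<open>Colour classes\<close>

text \<open>Serves for vertex and for boundary colours alike. Only its reflexive transitive closure
  matters: for edges \<open>A\<close>, its classes of points correspond to the components of the
  colour graph.\<close>

definition glue :: "'a set set set \<Rightarrow> 'a set set \<Rightarrow> ('a \<times> 'a) set" where
  "glue K A = {(x, y). (\<exists>C\<in>K. x \<in> \<Union>C \<and> y \<in> \<Union>C) \<or> (\<exists>a\<in>A. x \<in> a \<and> y \<in> a)}"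

lemma sym_glue: "sym (glue K A)"
  by (auto simp: sym_def glue_def)

lemma partition_on_unique:
  assumes "partition_on P S" "c \<in> S" "d \<in> S" "x \<in> c" "x \<in> d"
  shows "c = d"
  using assms by (auto simp: partition_on_def disjoint_def)

lemma partition_on_Union:
  assumes "partition_on P S" "partition_on S K"
  shows "partition_on P (\<Union> ` K)"
proof (rule partition_onI)
  show "\<Union> (\<Union> ` K) = P"
    using assms by (auto simp: partition_on_def)
  show "{} \<notin> \<Union> ` K"
  proof
    assume "{} \<in> \<Union> ` K"
    then obtain C where C: "C \<in> K" "\<Union>C = {}" by auto
    then obtain c where "c \<in> C" using partition_onD3[OF assms(2)] by fastforce
    then have "c = {}" "c \<in> S" using C partition_onD1[OF assms(2)] by blast+
    then show False using partition_onD3[OF assms(1)] by blast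
  qed
  fix p q assume "p \<in> \<Union> ` K" "q \<in> \<Union> ` K" "p \<noteq> q"
  then obtain C D where *: "C \<in> K" "p = \<Union>C" "D \<in> K" "q = \<Union>D" "C \<noteq> D" by auto
  then have "c \<in> S" "d \<in> S" if "c \<in> C" "d \<in> D" for c d
    using that assms(2) by (auto simp: partition_on_def)
  moreover have "c \<noteq> d" if "c \<in> C" "d \<in> D" for c d
    using partition_on_unique[OF assms(2) *(1,3)] *(5) that by auto
  ultimately show "disjnt p q"
    unfolding * disjnt_def using partition_on_unique[OF assms(1)] by blast
qed

text \<open>Sending a point to its colour class maps \<open>P\<close> onto the vertices of
  \<open>H\<close>. Gluings of points project to walks in \<open>H\<close>, and walks in
  \<open>H\<close> lift back, so both counts come from functions on \<open>P\<close> with the same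
  kernel.\<close>

lemma card_mcomponents:
  assumes S: "partition_on P S" and K: "partition_on S K" and A: "\<Union>A \<subseteq> P"
    and H: "mverts H = K" "\<And>a. a \<in> A \<Longrightarrow> ends H a = {C \<in> K. \<exists>c\<in>C. c \<inter> a \<noteq> {}}"
  shows "card (mcomponents H A) = card ((\<lambda>x. (glue K A)\<^sup>* `` {x}) ` P)"
proof -
  note U = partition_on_Union[OF S K]
  have "\<forall>x\<in>P. \<exists>C. C \<in> K \<and> x \<in> \<Union>C"
    using partition_onD1[OF U] by blast
  then obtain col where col: "\<And>x. x \<in> P \<Longrightarrow> col x \<in> K \<and> x \<in> \<Union>(col x)"
    by metis
  have KP: "\<Union>C \<subseteq> P" if "C \<in> K" for C using that partition_onD1[OF U] by blast
  have colI: "col x = C" if "C \<in> K" "x \<in> \<Union>C" for x C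
  proof -
    have x: "x \<in> P" using KP that by blast
    then have "\<exists>c\<in>C. x \<in> c" "\<exists>d\<in>col x. x \<in> d" using col that by auto
    then obtain c d where cd: "c \<in> C" "d \<in> col x" "x \<in> c" "x \<in> d" by blast
    then have "c \<in> S" "d \<in> S" using that col[OF x] partition_onD1[OF K] by blast+
    then have "c = d" using partition_on_unique[OF S] cd by blast
    then show ?thesis using partition_on_unique[OF K] cd that col[OF x] by blast
  qed
  have "C \<in> col ` P" if "C \<in> K" for C
  proof -
    have "\<Union>C \<noteq> {}" using that partition_onD3[OF U] by auto
    then obtain x where "x \<in> \<Union>C" by blast
    then show ?thesis using colI[OF that] KP[OF that] by blast
  qed
  then have K_eq: "K = col ` P" using col by blast
  have ends: "C \<in> ends H a \<longleftrightarrow> (\<exists>x\<in>a. C = col x)" if "a \<in> A" for a C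
  proof
    assume "C \<in> ends H a"
    then show "\<exists>x\<in>a. C = col x" using H(2)[OF that] colI by blast
  next
    assume "\<exists>x\<in>a. C = col x"
    then obtain x where "x \<in> a" "C = col x" by blast
    moreover from this have "x \<in> P" using A that by blast
    ultimately show "C \<in> ends H a" using H(2)[OF that] col[of x] by blast
  qed
  have to_adj: "(col x, col y) \<in> (madj H A)\<^sup>*" if "(x, y) \<in> (glue K A)\<^sup>*" "x \<in> P" for x y
    using that(1)
  proof induction
    case (step y z)
    from step(2) consider C where "C \<in> K" "y \<in> \<Union>C" "z \<in> \<Union>C" | a where "a \<in> A" "y \<in> a" "z \<in> a"
      by (auto simp: glue_def)
    then show ?case
    proof cases
      case 1
      then have "col y = col z" using colI by metis
      then show ?thesis using step by simp
    next
      case 2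
      then have "(col y, col z) \<in> madj H A" unfolding madj_def using ends[OF 2(1)] by blast
      then show ?thesis using step by auto
    qed
  qed auto
  have same: "(x, y) \<in> glue K A" if "col x = col y" "x \<in> P" "y \<in> P" for x y
    using col[OF that(2)] col[OF that(3)] that(1) unfolding glue_def by auto
  \<comment> \<open>All points of colour \<open>D\<close> are included, because a walk may enter a
    colour class at one point and leave it at another.\<close>
  have to_glue: "\<forall>y\<in>P. D = col y \<longrightarrow> (x, y) \<in> (glue K A)\<^sup>*"
    if "(col x, D) \<in> (madj H A)\<^sup>*" "x \<in> P" for x D
    using that(1)
  proof induction
    case base
    then show ?case using same that(2) by blast
  next
    case (step D D')
    from step(2) obtain a where a: "a \<in> A" "D \<in> ends H a" "D' \<in> ends H a"
      by (auto simp: madj_def)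
    then obtain u u' where u: "u \<in> a" "D = col u" "u' \<in> a" "D' = col u'"
      using a(2,3) unfolding ends[OF a(1)] by blast
    then have "u \<in> P" "u' \<in> P" "(u, u') \<in> glue K A" using a(1) A by (auto simp: glue_def)
    then have "(x, u') \<in> (glue K A)\<^sup>*" using step.IH u(2) by auto
    then show ?case using same[of u'] u(4) \<open>u' \<in> P\<close> by (blast intro: rtrancl_into_rtrancl)
  qed
  have comps: "mcomponents H A = (\<lambda>x. (madj H A)\<^sup>* `` {col x}) ` P"
    unfolding mcomponents_def quotient_image H(1) K_eq by (simp add: image_image)
  have kernel: "(madj H A)\<^sup>* `` {col x} = (madj H A)\<^sup>* `` {col y} \<longleftrightarrow>
      (glue K A)\<^sup>* `` {x} = (glue K A)\<^sup>* `` {y}" if "x \<in> P" "y \<in> P" for x y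
  proof -
    have "sym (madj H A)" by (auto simp: sym_def madj_def)
    then have "(madj H A)\<^sup>* `` {col x} = (madj H A)\<^sup>* `` {col y} \<longleftrightarrow> (col x, col y) \<in> (madj H A)\<^sup>*"
      by (rule rtrancl_class_eq_iff)
    also have "\<dots> \<longleftrightarrow> (x, y) \<in> (glue K A)\<^sup>*"
      using to_adj to_glue that by blast
    finally show ?thesis
      using rtrancl_class_eq_iff[OF sym_glue[of K A], of x y] by simp
  qed
  show ?thesis
    unfolding comps by (rule card_image_eq_kernel) (rule kernel)
qed

lemma glue_insert: "glue K (insert e A) = glue K A \<union> e \<times> e"
  by (auto simp: glue_def)

text \<open>Covers deletion, with boundary components, and contraction, with vertices, at once:
  \<open>S\<close> and \<open>S'\<close> are the sets before and after the operation at
  \<open>e\<close>, and \<open>K\<close> is the colouring before.\<close>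

locale recolouring =
  fixes P e :: "'a set" and S S' :: "'a set set" and K :: "'a set set set"
  assumes S: "partition_on P S" and S': "partition_on P S'" and K: "partition_on S K"
    and e: "e \<subseteq> P" "e \<noteq> {}"
    and untouched: "{c \<in> S. c \<inter> e = {}} = {c \<in> S'. c \<inter> e = {}}"
begin

definition "merged = {c \<in> \<Union>{C \<in> K. \<exists>c\<in>C. c \<inter> e \<noteq> {}}. c \<inter> e = {}} \<union> {c \<in> S'. c \<inter> e \<noteq> {}}"

lemma recolour_eq: "recolour e S' K = {C \<in> K. \<forall>c\<in>C. c \<inter> e = {}} \<union> {merged}"
  by (simp add: recolour_def merged_def)

lemma K_sub: "C \<in> K \<Longrightarrow> c \<in> C \<Longrightarrow> c \<in> S"
  using partition_onD1[OF K] by auto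

lemma covers: "x \<in> P \<Longrightarrow> \<exists>C\<in>K. \<exists>c\<in>C. x \<in> c" "x \<in> P \<Longrightarrow> \<exists>c\<in>S'. x \<in> c"
  using partition_onD1[OF K] partition_onD1[OF S] partition_onD1[OF S'] by auto

lemma inP: "c \<in> S \<Longrightarrow> c \<subseteq> P" "c \<in> S' \<Longrightarrow> c \<subseteq> P"
  using partition_onD1[OF S] partition_onD1[OF S'] by auto

lemma untouched_iff: "c \<inter> e = {} \<Longrightarrow> c \<in> S \<longleftrightarrow> c \<in> S'"
  using untouched by blast

lemma partition_on_recolour: "partition_on S' (recolour e S' K)"
proof (rule partition_onI)
  show "\<Union> (recolour e S' K) = S'"
  proof
    show "\<Union> (recolour e S' K) \<subseteq> S'"
    proof
      fix c assume "c \<in> \<Union> (recolour e S' K)"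
      then consider C where "C \<in> K" "c \<in> C" "c \<inter> e = {}" | "c \<in> S'"
        unfolding recolour_eq merged_def by blast
      then show "c \<in> S'" by cases (use K_sub untouched_iff in blast)+
    qed
    show "S' \<subseteq> \<Union> (recolour e S' K)"
    proof
      fix c assume c: "c \<in> S'"
      show "c \<in> \<Union> (recolour e S' K)"
      proof (cases "c \<inter> e = {}")
        case True
        then have "c \<in> S" using c untouched_iff by blast
        then obtain C where C: "C \<in> K" "c \<in> C" using partition_onD1[OF K] by auto
        show ?thesis
        proof (cases "\<forall>d\<in>C. d \<inter> e = {}")
          case True
          then have "C \<in> recolour e S' K" using C(1) unfolding recolour_eq by blast
          then show ?thesis using C(2) by blast
        next
          case False
          then have "c \<in> merged" using C \<open>c \<inter> e = {}\<close> unfolding merged_def by blast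
          then show ?thesis unfolding recolour_eq by blast
        qed
      next
        case False
        then have "c \<in> merged" using c unfolding merged_def by blast
        then show ?thesis unfolding recolour_eq by blast
      qed
    qed
  qed
  \<comment> \<open>A point of \<open>e\<close> lies in some member of \<open>S'\<close>, which then
    meets \<open>e\<close>; so the merged class is not empty.\<close>
  obtain x where "x \<in> e" using e by auto
  then have "merged \<noteq> {}" using covers(2)[of x] e by (auto simp: merged_def)
  then show "{} \<notin> recolour e S' K"
    using partition_onD3[OF K] by (auto simp: recolour_eq)
  have own: "c \<notin> merged" if "C \<in> K" "\<forall>c\<in>C. c \<inter> e = {}" "c \<in> C" for c C
    using that partition_on_unique[OF K] by (auto simp: merged_def)
  have other: "C = D" if "C \<in> K" "D \<in> K" "c \<in> C" "c \<in> D" for c C D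
    using that partition_on_unique[OF K] by blast
  show "disjnt C D" if CD: "C \<in> recolour e S' K" "D \<in> recolour e S' K" "C \<noteq> D" for C D
  proof -
    consider "C \<in> K" "\<forall>c\<in>C. c \<inter> e = {}" "D \<in> K" | "C \<in> K" "\<forall>c\<in>C. c \<inter> e = {}" "D = merged"
      | "C = merged" "D \<in> K" "\<forall>c\<in>D. c \<inter> e = {}"
      using CD unfolding recolour_eq by blast
    then show ?thesis
    proof cases
      case 1
      then show ?thesis using other \<open>C \<noteq> D\<close> unfolding disjnt_iff by blast
    qed (use own in \<open>auto simp: disjnt_iff\<close>)
  qed
qed

text \<open>The merged class covers exactly the points whose old class met \<open>e\<close>. Two
  such points are glued directly after recolouring, but before it only by passing into
  \<open>e\<close>, across \<open>e\<close> and out again; therefore the closures agree and not the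
  relations themselves.\<close>

lemma glue_recolour: "(glue (recolour e S' K) A)\<^sup>* = (glue K (insert e A))\<^sup>*"
proof (rule antisym)
  \<comment> \<open>If \<open>c\<close> missed \<open>e\<close>, it would be untouched and so belong
    to \<open>S\<close> too; sharing \<open>x\<close> with \<open>d\<close>, it would equal
    \<open>d\<close>.\<close>
  have touched: "c \<inter> e \<noteq> {}" if "c \<in> S'" "x \<in> c" "d \<in> S" "x \<in> d" "d \<inter> e \<noteq> {}" for c d x
    using that untouched_iff[of c] partition_on_unique[OF S, of c d x] by blast
  have touched': "d \<inter> e \<noteq> {}" if "c \<in> S'" "x \<in> c" "d \<in> S" "x \<in> d" "c \<inter> e \<noteq> {}" for c d x
    using that untouched_iff[of d] partition_on_unique[OF S', of c d x] by blast
  have in_merged: "(x, y) \<in> glue (recolour e S' K) A" if "x \<in> \<Union>merged" "y \<in> \<Union>merged" for x y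
    using that unfolding glue_def recolour_eq by simp
  have "glue K (insert e A) \<subseteq> glue (recolour e S' K) A"
  proof (rule subrelI)
    fix x y assume "(x, y) \<in> glue K (insert e A)"
    then consider (a) a where "a \<in> A" "x \<in> a" "y \<in> a"
      | (C) C where "C \<in> K" "\<forall>c\<in>C. c \<inter> e = {}" "x \<in> \<Union>C" "y \<in> \<Union>C"
      | (M) C d where "C \<in> K" "d \<in> C" "d \<inter> e \<noteq> {}" "x \<in> \<Union>C" "y \<in> \<Union>C"
      | (E) "x \<in> e" "y \<in> e"
      unfolding glue_def by blast
    then show "(x, y) \<in> glue (recolour e S' K) A"
    proof cases
      case M
      have "z \<in> \<Union>merged" if "z \<in> \<Union>C" for z
      proof -
        from that obtain c where c: "c \<in> C" "z \<in> c" by auto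
        show ?thesis
        proof (cases "c \<inter> e = {}")
          case True
          then show ?thesis using c M(1-3) unfolding merged_def by blast
        next
          case False
          have "c \<in> S" using K_sub M(1) c(1) by blast
          then obtain d where "d \<in> S'" "z \<in> d" using covers(2)[of z] inP c(2) by blast
          then have "d \<in> merged"
            using touched[of d z c] \<open>c \<in> S\<close> c(2) False unfolding merged_def by blast
          then show ?thesis using \<open>z \<in> d\<close> by blast
        qed
      qed
      then show ?thesis using in_merged M(4,5) by blast
    next
      case E
      have "z \<in> \<Union>merged" if "z \<in> e" for z
        using covers(2)[of z] that e(1) unfolding merged_def by blast
      then show ?thesis using in_merged E by blast
    qed (auto simp: glue_def recolour_eq)
  qed
  then show "(glue K (insert e A))\<^sup>* \<subseteq> (glue (recolour e S' K) A)\<^sup>*" by (rule rtrancl_mono)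
  have to_e: "\<exists>z\<in>e. (x, z) \<in> glue K A" if x: "x \<in> \<Union>merged" for x
  proof -
    have "\<exists>C\<in>K. \<exists>d\<in>C. d \<inter> e \<noteq> {} \<and> x \<in> \<Union>C"
    proof -
      from x consider c C d where "x \<in> c" "c \<in> C" "C \<in> K" "d \<in> C" "d \<inter> e \<noteq> {}"
        | c where "c \<in> S'" "c \<inter> e \<noteq> {}" "x \<in> c"
        unfolding merged_def by blast
      then show ?thesis
      proof cases
        case 1 then show ?thesis by blast
      next
        case 2
        then obtain C d where d: "C \<in> K" "d \<in> C" "x \<in> d" using covers(1)[of x] inP(2) by blast
        then have "d \<in> S" using K_sub by blast
        then have "d \<inter> e \<noteq> {}" using touched' 2 d(3) by blast
        then show ?thesis using d by blast
      qed
    qed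
    then show ?thesis unfolding glue_def by blast
  qed
  have "glue (recolour e S' K) A \<subseteq> (glue K (insert e A))\<^sup>*"
  proof (rule subrelI)
    fix x y assume "(x, y) \<in> glue (recolour e S' K) A"
    then consider "(x, y) \<in> glue K A" | "x \<in> \<Union>merged" "y \<in> \<Union>merged"
      unfolding glue_def recolour_eq by blast
    then show "(x, y) \<in> (glue K (insert e A))\<^sup>*"
    proof cases
      case 2
      then obtain u w where *: "u \<in> e" "(x, u) \<in> glue K A" "w \<in> e" "(y, w) \<in> glue K A"
        using to_e by blast
      then have "(x, u) \<in> glue K (insert e A)" "(u, w) \<in> glue K (insert e A)"
        "(w, y) \<in> glue K (insert e A)"
        using symD[OF sym_glue[of K A]] by (auto simp: glue_insert)
      then show ?thesis by (meson r_into_rtrancl rtrancl_into_rtrancl)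
    qed (auto simp: glue_insert)
  qed
  then show "(glue (recolour e S' K) A)\<^sup>* \<subseteq> (glue K (insert e A))\<^sup>*"
    by (rule rtrancl_subset_rtrancl)
qed

end

text \<open>The four corners lie in at most two members of \<open>S\<close>, hence in at most two
  colour classes, so adding \<open>e\<close> fuses two classes or none. For vertices the pairs of
  corners are the ends of the ribbon, for boundary components its sides.\<close>

lemma card_glue_edge:
  assumes P: "finite P" and S: "partition_on P S" and K: "partition_on S K"
    and e: "e = {p, q, r, s}" "e \<subseteq> P"
    and pq: "c \<in> S" "p \<in> c" "q \<in> c" and rs: "d \<in> S" "r \<in> d" "s \<in> d"
  shows "card ((\<lambda>x. (glue K {})\<^sup>* `` {x}) ` P) = card ((\<lambda>x. (glue K {e})\<^sup>* `` {x}) ` P)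
    + (if \<exists>C\<in>K. touching S e \<subseteq> C then 0 else 1)"
proof -
  have td: "touching S e = {c, d}"
  proof
    show "touching S e \<subseteq> {c, d}"
      using partition_on_unique[OF S] pq rs unfolding touching_def e(1) by blast
    show "{c, d} \<subseteq> touching S e" using pq rs by (auto simp: touching_def e(1))
  qed
  \<comment> \<open>Without edges there is nothing to chain: the unions of the colour classes
    already partition the points.\<close>
  have "trans (glue K {})"
  proof (rule transI)
    fix x y z assume "(x, y) \<in> glue K {}" "(y, z) \<in> glue K {}"
    then obtain C D where *: "C \<in> K" "x \<in> \<Union>C" "y \<in> \<Union>C" "D \<in> K" "y \<in> \<Union>D" "z \<in> \<Union>D"
      by (auto simp: glue_def)
    then have "\<Union>C = \<Union>D"
      using partition_on_unique[OF partition_on_Union[OF S K]] by blast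
    then show "(x, z) \<in> glue K {}" using * by (auto simp: glue_def)
  qed
  then have glue0: "(x, y) \<in> (glue K {})\<^sup>* \<longleftrightarrow> x = y \<or> (x, y) \<in> glue K {}" for x y
    by (metis rtrancl_eq_or_trancl trancl_id)
  obtain C D where C: "C \<in> K" "c \<in> C" and D: "D \<in> K" "d \<in> D"
    using pq rs partition_onD1[OF K] by blast
  have pr: "(p, r) \<in> (glue K {})\<^sup>* \<longleftrightarrow> (\<exists>C\<in>K. touching S e \<subseteq> C)"
  proof
    assume "\<exists>C\<in>K. touching S e \<subseteq> C"
    then show "(p, r) \<in> (glue K {})\<^sup>*" using pq rs unfolding td by (auto simp: glue_def)
  next
    assume "(p, r) \<in> (glue K {})\<^sup>*"
    then have "p = r \<or> (\<exists>E\<in>K. p \<in> \<Union>E \<and> r \<in> \<Union>E)" unfolding glue0 by (auto simp: glue_def)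
    then have "\<exists>E\<in>K. p \<in> \<Union>E \<and> r \<in> \<Union>E" using C pq(2) by blast
    then obtain E where "E \<in> K" "p \<in> \<Union>E" "r \<in> \<Union>E" by blast
    then have "\<Union>E = \<Union>C" "\<Union>E = \<Union>D"
      using partition_on_unique[OF partition_on_Union[OF S K]] C D pq rs by blast+
    then have "d \<subseteq> \<Union>C" using D by blast
    then obtain d' where "d' \<in> C" "r \<in> d'" using rs by blast
    then have "d' = d" using partition_on_unique[OF S] rs partition_onD1[OF K] C by blast
    then show "\<exists>C\<in>K. touching S e \<subseteq> C" using C \<open>d' \<in> C\<close> unfolding td by blast
  qed
  let ?f = "\<lambda>x. (glue K {})\<^sup>* `` {x}" and ?g = "\<lambda>x. (glue K {e})\<^sup>* `` {x}"
  note f_eq = rtrancl_class_eq_iff[OF sym_glue[of K "{}"]]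
    and g_eq = rtrancl_class_eq_iff[OF sym_glue[of K "{e}"]]
  have f_pq: "?f q = ?f p" "?f s = ?f r"
    unfolding f_eq using C D pq rs by (auto simp: glue_def intro!: r_into_rtrancl)
  have mono: "?g x = ?g y" if "?f x = ?f y" for x y
    using that rtrancl_mono[of "glue K {}" "glue K {e}"] unfolding f_eq g_eq
    by (auto simp: glue_insert)
  have ge: "?g x = ?g y" if "x \<in> e" "y \<in> e" for x y
    unfolding g_eq using that by (auto simp: glue_def)
  have fe: "?f x \<in> {?f p, ?f r}" if "x \<in> e" for x
    using that f_pq unfolding e(1) by auto
  \<comment> \<open>A chain of gluings changes the old class only by crossing \<open>e\<close>, and
    each crossing stays within the classes of \<open>p\<close> and \<open>r\<close>.\<close>
  have kernel: "?g x = ?g y \<longleftrightarrow> ?f x = ?f y \<or> ?f x \<in> {?f p, ?f r} \<and> ?f y \<in> {?f p, ?f r}" for x y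
  proof
    assume "?g x = ?g y"
    then have "(x, y) \<in> (glue K {e})\<^sup>*" by (simp only: g_eq)
    then show "?f x = ?f y \<or> ?f x \<in> {?f p, ?f r} \<and> ?f y \<in> {?f p, ?f r}"
    proof induction
      case (step y z)
      have "?f y = ?f z \<or> y \<in> e \<and> z \<in> e"
        using step(2) unfolding f_eq by (auto simp: glue_insert)
      then show ?case
      proof
        assume "?f y = ?f z"
        then show ?thesis using step.IH by simp
      next
        assume "y \<in> e \<and> z \<in> e"
        then have "?f y \<in> {?f p, ?f r}" "?f z \<in> {?f p, ?f r}" using fe by blast+
        then show ?thesis using step.IH by (metis (no_types))
      qed
    qed simp
  next
    have gpr: "?g p = ?g r" by (rule ge) (auto simp: e(1))
    assume "?f x = ?f y \<or> ?f x \<in> {?f p, ?f r} \<and> ?f y \<in> {?f p, ?f r}"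
    then show "?g x = ?g y" using mono gpr by (metis (no_types, lifting) insertE singletonD)
  qed
  show ?thesis
  proof (cases "?f p = ?f r")
    case True
    have "card (?f ` P) = card (?g ` P)"
      by (rule card_image_eq_kernel) (use kernel True in auto)
    moreover have "\<exists>C\<in>K. touching S e \<subseteq> C" using True pr f_eq by blast
    ultimately show ?thesis by simp
  next
    case False
    have "card (?f ` P) = Suc (card (?g ` P))"
      by (rule card_image_merge[of P p r, OF P _ _ False kernel]) (use e in auto)
    moreover have "\<not> (\<exists>C\<in>K. touching S e \<subseteq> C)" using False pr f_eq by blast
    ultimately show ?thesis by simp
  qed
qed

section \<open>Minors\<close>

definition edge_at :: "('a, 'm) ribbon_graph_scheme \<Rightarrow> 'a \<Rightarrow> 'a set" where
  "edge_at G p = {p, vstep G p, bstep G p, vstep G (bstep G p)}"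

lemma edges_eq: "edges G = edge_at G ` {p \<in> points G. vstep G p \<noteq> bstep G p}"
  by (simp add: edges_def edge_at_def[abs_def])

lemma ribbon_graphD:
  assumes "ribbon_graph G"
  shows "finite (points G)" "pairing_on (points G) (arc G)" "pairing_on (points G) (vstep G)"
    "pairing_on (points G) (bstep G)" "p \<in> points G \<Longrightarrow> vstep G (bstep G p) = bstep G (vstep G p)"
  using assms by (auto simp: ribbon_graph_def)

text \<open>On the corners of a ribbon \<open>vstep\<close> and \<open>bstep\<close> generate a
  Klein four-group acting freely. An edge is an orbit of this group and can be computed from any of
  its corners.\<close>

lemma edge_at_cong:
  assumes G: "ribbon_graph G" and p: "p \<in> points G" "vstep G p \<noteq> bstep G p" and q: "q \<in> edge_at G p"
  shows "q \<in> points G" "edge_at G q = edge_at G p" "vstep G q \<noteq> bstep G q"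
    "vstep G q \<in> edge_at G p" "bstep G q \<in> edge_at G p"
proof -
  define v b where vb: "v = vstep G" "b = bstep G"
  note V = pairing_onD[OF ribbon_graphD(3)[OF G], folded vb] and B = pairing_onD[OF ribbon_graphD(4)[OF G], folded vb]
  have in_P: "v p \<in> points G" "b p \<in> points G" "v (b p) \<in> points G"
    using V(1) B(1) p by auto
  have inv: "v (v p) = p" "b (b p) = p" "v (v (b p)) = b p" "b (v p) = v (b p)"
    using V(3)[OF p(1)] B(3)[OF p(1)] V(3)[OF in_P(2)] ribbon_graphD(5)[OF G p(1)]
    by (simp_all only: vb)
  then have inv': "b (v (b p)) = v p" using B(3)[OF in_P(1)] by simp
  have ne: "v p \<noteq> b p" "p \<noteq> v (b p)" using p(2) inv(3) by (auto simp: vb)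
  have e: "edge_at G x = {x, v x, b x, v (b x)}" for x by (simp add: edge_at_def vb)
  consider "q = p" | "q = v p" | "q = b p" | "q = v (b p)" using q unfolding e by blast
  then show "q \<in> points G" "edge_at G q = edge_at G p" "vstep G q \<noteq> bstep G q"
    "vstep G q \<in> edge_at G p" "bstep G q \<in> edge_at G p"
    unfolding e vb[symmetric] by (cases; use in_P inv inv' ne p in force)+
qed

lemma edge_point:
  assumes "ribbon_graph G" "e \<in> edges G" "q \<in> e"
  shows "q \<in> points G" "edge_at G q = e" "vstep G q \<noteq> bstep G q" "vstep G q \<in> e" "bstep G q \<in> e"
  using assms edge_at_cong[of G _ q] by (auto simp: edges_eq)

lemma edge_subset: "ribbon_graph G \<Longrightarrow> e \<in> edges G \<Longrightarrow> e \<subseteq> points G"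
  using edge_point(1)[of G e] by blast

lemma edge_nonempty: "e \<in> edges G \<Longrightarrow> e \<noteq> {}"
  by (auto simp: edges_eq edge_at_def)

lemma edges_disjoint:
  assumes "ribbon_graph G" "d \<in> edges G" "e \<in> edges G" "x \<in> d" "x \<in> e"
  shows "d = e"
  using edge_point(2)[OF assms(1,2,4)] edge_point(2)[OF assms(1,3,5)] by simp

lemma off_edges: "p \<in> points G \<Longrightarrow> p \<notin> \<Union>(edges G) \<Longrightarrow> vstep G p = bstep G p"
  by (auto simp: edges_eq edge_at_def)

lemma finite_edges: "ribbon_graph G \<Longrightarrow> finite (edges G)"
  using ribbon_graphD(1)[of G] by (auto simp: edges_eq)

section \<open>Deletion and contraction preserve coloured ribbon graphs\<close>

lemma delete_sel [simp]:
  "points (delete e G) = points G" "arc (delete e G) = arc G" "vstep (delete e G) = vstep G"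
  "bstep (delete e G) = (\<lambda>p. if p \<in> e then vstep G p else bstep G p)"
  "vclasses (delete e G) = vclasses G"
  "bclasses (delete e G) = recolour e (bdrys (delete e G)) (bclasses G)"
  by (simp_all add: delete_def del_ribbons_def bdrys_def)

lemma contract_sel [simp]:
  "points (contract e G) = points G" "arc (contract e G) = arc G" "bstep (contract e G) = bstep G"
  "vstep (contract e G) = (\<lambda>p. if p \<in> e then bstep G p else vstep G p)"
  "bclasses (contract e G) = bclasses G"
  "vclasses (contract e G) = recolour e (verts (contract e G)) (vclasses G)"
  by (simp_all add: contract_def contr_ribbon_def verts_def)

lemma verts_delete [simp]: "verts (delete e G) = verts G"
  by (simp add: verts_def)

lemma bdrys_contract [simp]: "bdrys (contract e G) = bdrys G"
  by (simp add: bdrys_def)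

lemma ribbon_graph_delete:
  assumes G: "ribbon_graph G" and e: "e \<in> edges G"
  shows "ribbon_graph (delete e G)"
proof -
  note E = edge_point[OF G e]
  have "pairing_on (points G) (\<lambda>p. if p \<in> e then vstep G p else bstep G p)"
    using E by (intro pairing_on_switch ribbon_graphD[OF G]) auto
  moreover have "vstep G p \<in> e \<longleftrightarrow> p \<in> e" if "p \<in> points G" for p
    using E(4)[of p] E(4)[of "vstep G p"] pairing_onD(3)[OF ribbon_graphD(3)[OF G] that] by auto
  ultimately show ?thesis
    using ribbon_graphD[OF G] by (auto simp: ribbon_graph_def)
qed

lemma ribbon_graph_contract:
  assumes G: "ribbon_graph G" and e: "e \<in> edges G"
  shows "ribbon_graph (contract e G)"
proof -
  note E = edge_point[OF G e]
  have "pairing_on (points G) (\<lambda>p. if p \<in> e then bstep G p else vstep G p)"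
    using E by (intro pairing_on_switch ribbon_graphD[OF G]) auto
  moreover have "bstep G p \<in> e \<longleftrightarrow> p \<in> e" if "p \<in> points G" for p
    using E(5)[of p] E(5)[of "bstep G p"] pairing_onD(3)[OF ribbon_graphD(4)[OF G] that] by auto
  ultimately show ?thesis
    using ribbon_graphD[OF G] by (auto simp: ribbon_graph_def)
qed

text \<open>Deletion and contraction both make \<open>vstep\<close> and \<open>bstep\<close> agree
  on \<open>e\<close>, and an edge exists only where they differ; one argument serves both.\<close>

lemma edges_minor:
  assumes G: "ribbon_graph G" and e: "e \<in> edges G"
    and H: "points H = points G" "\<And>p. p \<in> e \<Longrightarrow> vstep H p = bstep H p"
      "\<And>p. p \<notin> e \<Longrightarrow> vstep H p = vstep G p" "\<And>p. p \<notin> e \<Longrightarrow> bstep H p = bstep G p"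
  shows "edges H = edges G - {e}"
proof -
  have bstep_e: "bstep G p \<in> e \<longleftrightarrow> p \<in> e" if "p \<in> points G" for p
    using edge_point(5)[OF G e, of p] edge_point(5)[OF G e, of "bstep G p"]
      pairing_onD(3)[OF ribbon_graphD(4)[OF G] that] by auto
  have at: "edge_at H p = edge_at G p" if "p \<in> points G" "p \<notin> e" for p
    using that H bstep_e by (simp add: edge_at_def)
  have ne: "edge_at G p = e \<longleftrightarrow> p \<in> e" if "p \<in> points G" for p
    using edge_point(2)[OF G e, of p] by (auto simp: edge_at_def)
  have "{p \<in> points H. vstep H p \<noteq> bstep H p} = {p \<in> points G. vstep G p \<noteq> bstep G p} - e"
    using H by (auto, metis+)
  then have "edges H = edge_at G ` ({p \<in> points G. vstep G p \<noteq> bstep G p} - e)"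
    unfolding edges_eq using at by (auto intro!: image_cong)
  also have "\<dots> = edges G - {e}"
    unfolding edges_eq using ne by auto
  finally show ?thesis .
qed

lemma edges_delete: "ribbon_graph G \<Longrightarrow> e \<in> edges G \<Longrightarrow> edges (delete e G) = edges G - {e}"
  by (rule edges_minor) auto

lemma edges_contract: "ribbon_graph G \<Longrightarrow> e \<in> edges G \<Longrightarrow> edges (contract e G) = edges G - {e}"
  by (rule edges_minor) auto

lemma partition_on_verts: "ribbon_graph G \<Longrightarrow> partition_on (points G) (verts G)"
  unfolding verts_def by (intro partition_on_orbits ribbon_graphD)

lemma partition_on_bdrys: "ribbon_graph G \<Longrightarrow> partition_on (points G) (bdrys G)"
  unfolding bdrys_def by (intro partition_on_orbits ribbon_graphD)

lemma coloured_ribbon_graphD: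
  assumes "coloured_ribbon_graph G"
  shows "ribbon_graph G" "partition_on (verts G) (vclasses G)" "partition_on (bdrys G) (bclasses G)"
  using assms by (auto simp: coloured_ribbon_graph_def)

lemma recolouring_delete:
  assumes "coloured_ribbon_graph G" "e \<in> edges G"
  shows "recolouring (points G) e (bdrys G) (bdrys (delete e G)) (bclasses G)"
proof
  note G = coloured_ribbon_graphD[OF assms(1)]
  show "partition_on (points G) (bdrys G)" "partition_on (bdrys G) (bclasses G)"
    using partition_on_bdrys G by auto
  show "partition_on (points G) (bdrys (delete e G))"
    using partition_on_bdrys[OF ribbon_graph_delete[OF G(1) assms(2)]] by simp
  show "e \<subseteq> points G" "e \<noteq> {}" using edge_subset[OF G(1)] edge_nonempty assms(2) by auto
  show "{c \<in> bdrys G. c \<inter> e = {}} = {c \<in> bdrys (delete e G). c \<inter> e = {}}"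
    unfolding bdrys_def by (simp, rule untouched_orbits_eq, simp)
qed

lemma recolouring_contract:
  assumes "coloured_ribbon_graph G" "e \<in> edges G"
  shows "recolouring (points G) e (verts G) (verts (contract e G)) (vclasses G)"
proof
  note G = coloured_ribbon_graphD[OF assms(1)]
  show "partition_on (points G) (verts G)" "partition_on (verts G) (vclasses G)"
    using partition_on_verts G by auto
  show "partition_on (points G) (verts (contract e G))"
    using partition_on_verts[OF ribbon_graph_contract[OF G(1) assms(2)]] by simp
  show "e \<subseteq> points G" "e \<noteq> {}" using edge_subset[OF G(1)] edge_nonempty assms(2) by auto
  show "{c \<in> verts G. c \<inter> e = {}} = {c \<in> verts (contract e G). c \<inter> e = {}}"
    unfolding verts_def by (simp, rule untouched_orbits_eq, simp)
qed

lemma coloured_ribbon_graph_delete: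
  assumes "coloured_ribbon_graph G" "e \<in> edges G"
  shows "coloured_ribbon_graph (delete e G)"
  using assms coloured_ribbon_graphD[OF assms(1)] ribbon_graph_delete
    recolouring.partition_on_recolour[OF recolouring_delete[OF assms]]
  by (simp add: coloured_ribbon_graph_def)

lemma coloured_ribbon_graph_contract:
  assumes "coloured_ribbon_graph G" "e \<in> edges G"
  shows "coloured_ribbon_graph (contract e G)"
  using assms coloured_ribbon_graphD[OF assms(1)] ribbon_graph_contract
    recolouring.partition_on_recolour[OF recolouring_contract[OF assms]]
  by (simp add: coloured_ribbon_graph_def)

section \<open>Component counts of minors\<close>

definition kV :: "'a coloured_ribbon_graph \<Rightarrow> 'a set set \<Rightarrow> nat" where
  "kV G A = card (mcomponents (vgraph G) A)"

definition kB :: "'a coloured_ribbon_graph \<Rightarrow> 'a set set \<Rightarrow> nat" where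
  "kB G A = card (mcomponents (bgraph G) A)"

lemma kV_eq_glue:
  assumes "coloured_ribbon_graph G" "A \<subseteq> edges G"
  shows "kV G A = card ((\<lambda>x. (glue (vclasses G) A)\<^sup>* `` {x}) ` points G)"
proof -
  note G = coloured_ribbon_graphD[OF assms(1)]
  have "\<Union>A \<subseteq> points G" using edge_subset[OF G(1)] assms(2) by blast
  then show ?thesis
    unfolding kV_def by (rule card_mcomponents[OF partition_on_verts[OF G(1)] G(2)]) (auto simp: vgraph_def)
qed

lemma kB_eq_glue:
  assumes "coloured_ribbon_graph G" "A \<subseteq> edges G"
  shows "kB G A = card ((\<lambda>x. (glue (bclasses G) A)\<^sup>* `` {x}) ` points G)"
proof -
  note G = coloured_ribbon_graphD[OF assms(1)]
  have "\<Union>A \<subseteq> points G" using edge_subset[OF G(1)] assms(2) by blast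
  then show ?thesis
    unfolding kB_def by (rule card_mcomponents[OF partition_on_bdrys[OF G(1)] G(3)]) (auto simp: bgraph_def)
qed

lemma card_mcomponents_empty: "card (mcomponents H {}) = card (mverts H)"
proof -
  have "(madj H {})\<^sup>* = Id" by (simp add: madj_def)
  then have "mcomponents H {} = (\<lambda>x. {x}) ` mverts H"
    by (simp add: mcomponents_def quotient_image)
  then show ?thesis by (simp add: card_image)
qed

lemma kV_empty: "kV G {} = card (vclasses G)"
  by (simp add: kV_def card_mcomponents_empty vgraph_def)

lemma kB_empty: "kB G {} = card (bclasses G)"
  by (simp add: kB_def card_mcomponents_empty bgraph_def)

lemma kV_delete: "kV (delete e G) A = kV G A"
  by (simp add: kV_def mcomponents_def madj_def vgraph_def)

lemma kB_contract: "kB (contract e G) A = kB G A"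
  by (simp add: kB_def mcomponents_def madj_def bgraph_def)

text \<open>Merging the boundary classes at \<open>e\<close> contracts \<open>e\<close> in
  \<open>bgraph G\<close>.\<close>

lemma kB_delete:
  assumes "coloured_ribbon_graph G" "e \<in> edges G" "A \<subseteq> edges G - {e}"
  shows "kB (delete e G) A = kB G (insert e A)"
proof -
  have "A \<subseteq> edges (delete e G)" "insert e A \<subseteq> edges G"
    using assms edges_delete[OF coloured_ribbon_graphD(1)[OF assms(1)] assms(2)] by auto
  then show ?thesis
    using recolouring.glue_recolour[OF recolouring_delete[OF assms(1,2)], of A]
    by (simp add: kB_eq_glue coloured_ribbon_graph_delete assms(1,2))
qed

lemma kV_contract:
  assumes "coloured_ribbon_graph G" "e \<in> edges G" "A \<subseteq> edges G - {e}"
  shows "kV (contract e G) A = kV G (insert e A)"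
proof -
  have "A \<subseteq> edges (contract e G)" "insert e A \<subseteq> edges G"
    using assms edges_contract[OF coloured_ribbon_graphD(1)[OF assms(1)] assms(2)] by auto
  then show ?thesis
    using recolouring.glue_recolour[OF recolouring_contract[OF assms(1,2)], of A]
    by (simp add: kV_eq_glue coloured_ribbon_graph_contract assms(1,2))
qed

lemma bcount_eq:
  "bcount G A = card (orbits (points G) (arc G) (\<lambda>p. if p \<in> \<Union>(edges G - A) then vstep G p else bstep G p))"
  by (simp add: bcount_def bdrys_def del_ribbons_def)

lemma bcount_edges: "bcount G (edges G) = card (bdrys G)"
  by (simp add: bcount_eq bdrys_def)

text \<open>Once all ribbons are gone, the boundary consists of the circles of the vertex discs;
  blank segments follow them anyway.\<close>

lemma bcount_empty: "bcount G {} = card (verts G)"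
  unfolding bcount_eq verts_def
  by (intro arg_cong[where f = card] orbits_cong) (auto simp: off_edges)

lemma bcount_delete:
  assumes "ribbon_graph G" "e \<in> edges G" "A \<subseteq> edges G - {e}"
  shows "bcount (delete e G) A = bcount G A"
proof -
  have "\<Union>(edges G - A) = \<Union>(edges G - {e} - A) \<union> e" using assms(2,3) by blast
  then show ?thesis
    unfolding bcount_eq edges_delete[OF assms(1,2)] delete_sel
    by (intro arg_cong[where f = card] orbits_cong) auto
qed

lemma bcount_contract:
  assumes "ribbon_graph G" "e \<in> edges G" "A \<subseteq> edges G - {e}"
  shows "bcount (contract e G) A = bcount G (insert e A)"
proof -
  have "p \<notin> e" if "p \<in> \<Union>(edges G - insert e A)" for p
    using that edges_disjoint[OF assms(1) _ assms(2)] by blast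
  moreover have "edges G - {e} - A = edges G - insert e A" by blast
  ultimately show ?thesis
    unfolding bcount_eq edges_contract[OF assms(1,2)] contract_sel
    by (intro arg_cong[where f = card] orbits_cong) auto
qed

text \<open>The counts of the iterated minor are expressed through G and the set of removed edges.
  This is how the arbitrary order allowed in \<open>has_type\<close> disappears.\<close>

lemma fold_delete:
  assumes "coloured_ribbon_graph G" "distinct es" "set es \<subseteq> edges G"
  shows "coloured_ribbon_graph (fold delete es G) \<and> edges (fold delete es G) = edges G - set es \<and>
    (\<forall>A\<subseteq>edges G - set es. kV (fold delete es G) A = kV G A \<and>
      kB (fold delete es G) A = kB G (A \<union> set es) \<and> bcount (fold delete es G) A = bcount G A)"
  using assms
proof (induction es arbitrary: G)
  case (Cons e es)
  have R: "ribbon_graph G" and e: "e \<in> edges G"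
    using coloured_ribbon_graphD(1) Cons.prems by auto
  note edges = edges_delete[OF R e]
  have IH: "coloured_ribbon_graph (fold delete es (delete e G))"
    "edges (fold delete es (delete e G)) = edges G - {e} - set es"
    "\<And>A. A \<subseteq> edges G - {e} - set es \<Longrightarrow>
      kV (fold delete es (delete e G)) A = kV (delete e G) A \<and>
      kB (fold delete es (delete e G)) A = kB (delete e G) (A \<union> set es) \<and>
      bcount (fold delete es (delete e G)) A = bcount (delete e G) A"
    using Cons.IH[OF coloured_ribbon_graph_delete[OF Cons.prems(1) e]] Cons.prems(2,3)
    unfolding edges by auto
  have "kV (fold delete es (delete e G)) A = kV G A \<and> kB (fold delete es (delete e G)) A = kB G (A \<union> set (e # es)) \<and>
      bcount (fold delete es (delete e G)) A = bcount G A" if A: "A \<subseteq> edges G - set (e # es)" for A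
  proof -
    have sub: "A \<subseteq> edges G - {e} - set es" "A \<subseteq> edges G - {e}" "A \<union> set es \<subseteq> edges G - {e}"
      using A Cons.prems(2,3) by auto
    show ?thesis
      using IH(3)[OF sub(1)] kV_delete kB_delete[OF Cons.prems(1) e sub(3)]
        bcount_delete[OF R e sub(2)]
      by simp
  qed
  moreover have "edges G - {e} - set es = edges G - set (e # es)" by auto
  ultimately show ?case using IH(1,2) by (simp del: set_simps)
qed simp

lemma fold_contract:
  assumes "coloured_ribbon_graph G" "distinct es" "set es \<subseteq> edges G"
  shows "coloured_ribbon_graph (fold contract es G) \<and> edges (fold contract es G) = edges G - set es \<and>
    (\<forall>A\<subseteq>edges G - set es. kV (fold contract es G) A = kV G (A \<union> set es) \<and>
      kB (fold contract es G) A = kB G A \<and> bcount (fold contract es G) A = bcount G (A \<union> set es))"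
  using assms
proof (induction es arbitrary: G)
  case (Cons e es)
  have R: "ribbon_graph G" and e: "e \<in> edges G"
    using coloured_ribbon_graphD(1) Cons.prems by auto
  note edges = edges_contract[OF R e]
  have IH: "coloured_ribbon_graph (fold contract es (contract e G))"
    "edges (fold contract es (contract e G)) = edges G - {e} - set es"
    "\<And>A. A \<subseteq> edges G - {e} - set es \<Longrightarrow>
      kV (fold contract es (contract e G)) A = kV (contract e G) (A \<union> set es) \<and>
      kB (fold contract es (contract e G)) A = kB (contract e G) A \<and>
      bcount (fold contract es (contract e G)) A = bcount (contract e G) (A \<union> set es)"
    using Cons.IH[OF coloured_ribbon_graph_contract[OF Cons.prems(1) e]] Cons.prems(2,3)
    unfolding edges by auto
  have "kV (fold contract es (contract e G)) A = kV G (A \<union> set (e # es)) \<and> kB (fold contract es (contract e G)) A = kB G A \<and>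
      bcount (fold contract es (contract e G)) A = bcount G (A \<union> set (e # es))" if A: "A \<subseteq> edges G - set (e # es)" for A
  proof -
    have sub: "A \<subseteq> edges G - {e} - set es" "A \<subseteq> edges G - {e}" "A \<union> set es \<subseteq> edges G - {e}"
      using A Cons.prems(2,3) by auto
    show ?thesis
      using IH(3)[OF sub(1)] kV_contract[OF Cons.prems(1) e sub(3)] kB_contract
        bcount_contract[OF R e sub(3)]
      by simp
  qed
  moreover have "edges G - {e} - set es = edges G - set (e # es)" by auto
  ultimately show ?case using IH(1,2) by (simp del: set_simps)
qed simp


section \<open>Edge types and counts\<close>

lemma orbit_pair:
  assumes "x \<in> P"
  obtains c where "c \<in> orbits P f g" "x \<in> c" "g x \<in> c"
proof (rule that)
  show "(orel P f g)\<^sup>* `` {x} \<in> orbits P f g" "x \<in> (orel P f g)\<^sup>* `` {x}"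
    using assms by (auto simp: orbits_image)
  then show "g x \<in> (orel P f g)\<^sup>* `` {x}" using assms orbit_closed(2) by metis
qed

text \<open>The loss of boundary components when the ribbon is attached to the bare vertices.
  \<open>(1 + rho_defect t) / 2\<close> is the value of rho for a single edge of type
  \<open>t\<close>: 1, 0 or 1/2.\<close>

fun rho_defect :: "etype \<Rightarrow> rat" where
  "rho_defect Bs = 1"
| "rho_defect Bp = 1"
| "rho_defect Olc = - 1"
| "rho_defect Olh = - 1"
| "rho_defect Nl = 0"

lemma one_edge_type_counts:
  assumes H: "coloured_ribbon_graph H" and e: "edges H = {e}"
  shows "kV H {} = kV H {e} + of_bool (one_edge_type H e = Bs)"
    and "kB H {} = kB H {e} + of_bool (one_edge_type H e = Olc)"
    and "rat_of_nat (bcount H {}) - rat_of_nat (bcount H {e}) = rho_defect (one_edge_type H e)"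
proof -
  note R = coloured_ribbon_graphD[OF H]
  note ribbon = ribbon_graphD[OF R(1)]
  from e have "e \<in> edges H" by simp
  then obtain p where p: "p \<in> points H" "vstep H p \<noteq> bstep H p" and e_eq: "e = edge_at H p"
    by (auto simp: edges_eq)
  have off_e: "vstep H y = bstep H y" if "y \<in> points H" "y \<notin> e" for y
    using off_edges[of y H] that e by simp
  interpret one_edge "points H" "arc H" "vstep H" "bstep H" p
    by unfold_locales
      (rule ribbon(1-4) p ribbon(5)[OF p(1)] off_e[unfolded e_eq edge_at_def], (assumption+)?)+
  note e_eq = e_eq[unfolded edge_at_def]
  \<comment> \<open>The same corners, reordered so that corners joined by a side of the ribbon are
    adjacent; this is the form needed for boundary components.\<close>
  have e_eq': "e = {p, bstep H p, vstep H p, vstep H (bstep H p)}" unfolding e_eq by auto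
  note in_P = corners(1)
  obtain c d where c: "c \<in> verts H" "p \<in> c" "vstep H p \<in> c"
    and d: "d \<in> verts H" "bstep H p \<in> d" "vstep H (bstep H p) \<in> d"
    unfolding verts_def using in_P by (metis insert_subset orbit_pair)
  obtain c' d' where c': "c' \<in> bdrys H" "p \<in> c'" "bstep H p \<in> c'"
    and d': "d' \<in> bdrys H" "vstep H p \<in> d'" "bstep H (vstep H p) \<in> d'"
    unfolding bdrys_def using in_P by (metis insert_subset orbit_pair)
  have kV: "kV H {} = kV H {e} + (if \<exists>C\<in>vclasses H. touching (verts H) e \<subseteq> C then 0 else 1)"
    using card_glue_edge[OF ribbon(1) partition_on_verts[OF R(1)] R(2) e_eq _ c d] in_P e e_eq
    by (simp add: kV_eq_glue[OF H])
  have kB: "kB H {} = kB H {e} + (if \<exists>C\<in>bclasses H. touching (bdrys H) e \<subseteq> C then 0 else 1)"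
    using card_glue_edge[OF ribbon(1) partition_on_bdrys[OF R(1)] R(3) e_eq' _ c' d'[unfolded corners(12)]]
      in_P e e_eq
    by (simp add: kB_eq_glue[OF H])
  \<comment> \<open>As \<open>e\<close> is the only edge, the two counts are the numbers of vertices
    and of boundary components, which differ only in those meeting \<open>e\<close>.\<close>
  have b: "bcount H {} + card (touching (bdrys H) e) = bcount H {e} + card (touching (verts H) e)"
    using card_orbits_touching[of "points H" e "vstep H" "bstep H" "arc H", OF ribbon(1) off_e]
      bcount_edges[of H] e
    unfolding verts_def bdrys_def bcount_empty by simp
  \<comment> \<open>A loop meets only one vertex and so cannot join two colour classes. The dual
    fact \<open>bs\<close> serves non-loops and non-orientable loops.\<close>
  have vs: "\<exists>C\<in>vclasses H. touching (verts H) e \<subseteq> C" if one: "card (touching (verts H) e) = 1"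
  proof -
    obtain c where "touching (verts H) e = {c}" by (rule card_1_singletonE[OF one])
    moreover from this have "c \<in> verts H" unfolding touching_def by blast
    ultimately show ?thesis using partition_onD1[OF R(2)] by auto
  qed
  have bs: "\<exists>C\<in>bclasses H. touching (bdrys H) e \<subseteq> C" if one: "card (touching (bdrys H) e) = 1"
  proof -
    obtain c where "touching (bdrys H) e = {c}" by (rule card_1_singletonE[OF one])
    moreover from this have "c \<in> bdrys H" unfolding touching_def by blast
    ultimately show ?thesis using partition_onD1[OF R(3)] by auto
  qed
  have loop: "loop H e \<longleftrightarrow> card (touching (verts H) e) = 1"
    by (simp add: loop_def touching_def)
  have ball: "(\<forall>v\<in>verts H. v \<inter> e \<noteq> {} \<longrightarrow> (\<forall>p\<in>v. Q p)) \<longleftrightarrow> (\<forall>y\<in>\<Union>(touching (verts H) e). Q y)" for Q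
    by (auto simp: touching_def)
  have orientable: "orientable_loop H e \<longleftrightarrow> card (touching (verts H) e) = 1 \<and>
    (\<exists>S. (\<forall>y\<in>\<Union>(touching (verts H) e). (arc H y \<in> S \<longleftrightarrow> y \<notin> S) \<and> (vstep H y \<in> S \<longleftrightarrow> y \<notin> S)) \<and>
      (\<forall>y\<in>e. bstep H y \<in> S \<longleftrightarrow> y \<notin> S))"
    unfolding orientable_loop_def loop ball ..
  have type: "one_edge_type H e =
     (if card (touching (verts H) e) \<noteq> 1 then
        (if \<exists>C\<in>vclasses H. touching (verts H) e \<subseteq> C then Bp else Bs)
      else if orientable_loop H e then
        (if \<exists>C\<in>bclasses H. touching (bdrys H) e \<subseteq> C then Olh else Olc)
      else Nl)"
    unfolding one_edge_type_def loop touching_def[symmetric] by simp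
  consider "card (touching (verts H) e) = 2" "card (touching (bdrys H) e) = 1"
    | "card (touching (verts H) e) = 1" "card (touching (bdrys H) e) = 2" "orientable_loop H e"
    | "card (touching (verts H) e) = 1" "card (touching (bdrys H) e) = 1" "\<not> orientable_loop H e"
  proof (cases rule: corner_pairing_cases[folded verts_def bdrys_def e_eq, case_names sides untwisted twisted])
    case sides
    then show thesis by (rule that(1))
  next
    case untwisted
    then have "orientable_loop H e" unfolding orientable by blast
    then show thesis using untwisted(1,2) that(2) by blast
  next
    case twisted
    then have "\<not> orientable_loop H e" unfolding orientable by blast
    then show thesis using twisted(1,2) that(3) by blast
  qed
  then have "kV H {} = kV H {e} + of_bool (one_edge_type H e = Bs) \<and>
    kB H {} = kB H {e} + of_bool (one_edge_type H e = Olc) \<and>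
    rat_of_nat (bcount H {}) - rat_of_nat (bcount H {e}) = rho_defect (one_edge_type H e)"
  proof cases
    case 1
    then have "bcount H {} = bcount H {e} + 1" using b by simp
    then show ?thesis using 1 kV kB bs type by simp
  next
    case 2
    then have "bcount H {e} = bcount H {} + 1" using b by simp
    then show ?thesis using 2 kV kB vs type by simp
  next
    case 3
    then have "bcount H {e} = bcount H {}" using b by simp
    then show ?thesis using 3 kV kB vs bs type by simp
  qed
  then show "kV H {} = kV H {e} + of_bool (one_edge_type H e = Bs)"
    "kB H {} = kB H {e} + of_bool (one_edge_type H e = Olc)"
    "rat_of_nat (bcount H {}) - rat_of_nat (bcount H {e}) = rho_defect (one_edge_type H e)"
    by auto
qed

text \<open>Contracting the other edges shifts the subsets counted by \<open>kV\<close> and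
  \<open>bcount\<close> from \<open>{}\<close> and \<open>{e}\<close> to the top of the lattice but
  leaves those of \<open>kB\<close> at the bottom. For deletion the roles are reversed: only
  \<open>kB\<close> moves to the top.\<close>

lemma has_type_counts:
  assumes G: "coloured_ribbon_graph G" and e: "e \<in> edges G" and t: "has_type G e (i, j)"
  shows "kV G (edges G - {e}) = kV G (edges G) + of_bool (i = Bs)"
    and "kB G {} = kB G {e} + of_bool (i = Olc)"
    and "rat_of_nat (bcount G (edges G - {e})) - rat_of_nat (bcount G (edges G)) = rho_defect i"
    and "kV G {} = kV G {e} + of_bool (j = Bs)"
    and "kB G (edges G - {e}) = kB G (edges G) + of_bool (j = Olc)"
    and "rat_of_nat (bcount G {}) - rat_of_nat (bcount G {e}) = rho_defect j"
proof -
  from t obtain es where es: "distinct es" "set es = edges G - {e}"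
    and i: "i = one_edge_type (fold contract es G) e" and j: "j = one_edge_type (fold delete es G) e"
    by (auto simp: has_type_def)
  have rest: "edges G - set es = {e}" "insert e (set es) = edges G"
    using e es(2) by auto
  note C = fold_contract[OF G es(1), unfolded rest] and D = fold_delete[OF G es(1), unfolded rest]
  have C': "coloured_ribbon_graph (fold contract es G)" "edges (fold contract es G) = {e}"
    and D': "coloured_ribbon_graph (fold delete es G)" "edges (fold delete es G) = {e}"
    using C D es(2) by auto
  have "kV (fold contract es G) {} = kV G (edges G - {e})" "kV (fold contract es G) {e} = kV G (edges G)"
    "kB (fold contract es G) {} = kB G {}" "kB (fold contract es G) {e} = kB G {e}"
    "bcount (fold contract es G) {} = bcount G (edges G - {e})"
    "bcount (fold contract es G) {e} = bcount G (edges G)"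
    using C es(2) e by (auto simp: insert_absorb)
  then show "kV G (edges G - {e}) = kV G (edges G) + of_bool (i = Bs)"
    "kB G {} = kB G {e} + of_bool (i = Olc)"
    "rat_of_nat (bcount G (edges G - {e})) - rat_of_nat (bcount G (edges G)) = rho_defect i"
    using one_edge_type_counts[OF C'] unfolding i by simp_all
  have "kV (fold delete es G) {} = kV G {}" "kV (fold delete es G) {e} = kV G {e}"
    "kB (fold delete es G) {} = kB G (edges G - {e})" "kB (fold delete es G) {e} = kB G (edges G)"
    "bcount (fold delete es G) {} = bcount G {}" "bcount (fold delete es G) {e} = bcount G {e}"
    using D es(2) e by (auto simp: insert_absorb)
  then show "kV G {} = kV G {e} + of_bool (j = Bs)"
    "kB G (edges G - {e}) = kB G (edges G) + of_bool (j = Olc)"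
    "rat_of_nat (bcount G {}) - rat_of_nat (bcount G {e}) = rho_defect j"
    using one_edge_type_counts[OF D'] unfolding j by simp_all
qed

lemma has_type_exists:
  assumes "coloured_ribbon_graph G"
  obtains i j where "has_type G e (i, j)"
  using finite_distinct_list[of "edges G - {e}"] finite_edges coloured_ribbon_graphD(1)[OF assms]
  unfolding has_type_def by blast

section \<open>Monomials\<close>

text \<open>Exponent vectors as plain functions. As \<open>indet\<close> is finite, every function
  has finite support, and identities between monomials become pointwise arithmetic in the
  rationals.\<close>

definition mon :: "(indet \<Rightarrow> rat) \<Rightarrow> indet fpoly" where
  "mon f = monomial (Abs_poly_mapping f)"

lemma finite_indet: "finite (A :: indet set)"
proof -
  have "A \<subseteq> {I_alpha, I_beta, I_gamma, I_a_bs, I_a_bp, I_a_olc, I_a_olh, I_b_bs, I_b_bp, I_b_olc, I_b_olh}"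
    using indet.exhaust by blast
  then show ?thesis by (rule finite_subset) simp
qed

lemma lookup_Abs_indet: "Poly_Mapping.lookup (Abs_poly_mapping (f :: indet \<Rightarrow> rat)) = f"
  by (rule lookup_Abs_poly_mapping) (rule finite_indet)

lemma Abs_indet_eqI: "(\<And>i. Poly_Mapping.lookup m i = f i) \<Longrightarrow> m = Abs_poly_mapping (f :: indet \<Rightarrow> rat)"
  by (rule poly_mapping_eqI) (simp add: lookup_Abs_indet)

lemma mono_one: "1 = mon (\<lambda>_. 0)"
  unfolding mon_def monomial_def
  by (subst Abs_indet_eqI[of 0 "\<lambda>_. 0", symmetric]) simp_all

lemma mono_mult: "mon f * mon g = mon (\<lambda>i. f i + g i)"
  unfolding mon_def monomial_def mult_single
  by (subst Abs_indet_eqI[of "_ + _" "\<lambda>i. f i + g i"]) (simp_all add: lookup_add lookup_Abs_indet)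

lemma mono_power: "mon f ^ n = mon (\<lambda>i. of_nat n * f i)"
  by (induction n) (simp_all add: mono_one mono_mult algebra_simps)

lemma mono_mpow: "mon f \<up> q = mon (\<lambda>i. q * f i)"
proof -
  \<comment> \<open>A monomial has a single key, so the description in \<open>mpow\<close> is
    uniquely satisfied.\<close>
  have "(THE m. mon f = monomial m) = Abs_poly_mapping f"
    unfolding mon_def monomial_def 
    by (rule the_equality) (auto dest: arg_cong[where f = Poly_Mapping.keys])
  then show ?thesis
    unfolding mpow_def
    by (subst Abs_indet_eqI[of _ "\<lambda>i. q * f i"])
      (auto simp: mon_def map.rep_eq lookup_Abs_indet when_def)
qed

lemma mono_mdiv: "mon f \<oslash> mon g = mon (\<lambda>i. f i - g i)"
  by (simp add: mdiv_def mono_mpow mono_mult)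

lemma mono_var: "var i = mon (\<lambda>j. of_bool (j = i))"
  unfolding var_def mon_def
  by (subst Abs_indet_eqI[of "Poly_Mapping.single i 1"]) (auto simp: lookup_single when_def)

lemmas mono_simps = mono_mult mono_power mono_mpow mono_mdiv mono_var

lemma mono_in_coeff_ring:
  "mon f \<in> coeff_ring \<longleftrightarrow> (\<forall>i. (if i \<in> half_exponents then 2 * f i else f i) \<in> \<nat>)"
  by (simp add: coeff_ring_def mon_def monomial_def lookup_Abs_indet)

lemma coeff_ring_add: "p \<in> coeff_ring \<Longrightarrow> q \<in> coeff_ring \<Longrightarrow> p + q \<in> coeff_ring"
  using Poly_Mapping.keys_add[of p q] unfolding coeff_ring_def by blast

lemma coeff_ring_mult:
  assumes "p \<in> coeff_ring" "q \<in> coeff_ring"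
  shows "p * q \<in> coeff_ring"
proof -
  \<comment> \<open>Doubling the half-integral exponents turns membership into a condition that is
    additive in the exponent.\<close>
  define s where "s i c = (if i \<in> half_exponents then 2 * c else c)" for i and c :: rat
  have s: "s i (c + d) = s i c + s i d" for i c d by (simp add: s_def)
  show ?thesis
    using assms keys_mult[of p q] unfolding coeff_ring_def s_def[symmetric]
    by (fastforce simp: lookup_add s)
qed

section \<open>Exponent vectors of the recursion coefficients\<close>

fun acoef_exp :: "etype \<Rightarrow> indet \<Rightarrow> rat" where
  "acoef_exp Bs = (\<lambda>i. of_bool (i = I_a_bs))"
| "acoef_exp Bp = (\<lambda>i. of_bool (i = I_a_bp))"
| "acoef_exp Olc = (\<lambda>i. of_bool (i = I_a_olc))"
| "acoef_exp Olh = (\<lambda>i. of_bool (i = I_a_olh))"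
| "acoef_exp Nl = (\<lambda>i. (of_bool (i = I_a_bp) + of_bool (i = I_a_olh)) / 2)"

fun bcoef_exp :: "etype \<Rightarrow> indet \<Rightarrow> rat" where
  "bcoef_exp Bs = (\<lambda>i. of_bool (i = I_b_bs))"
| "bcoef_exp Bp = (\<lambda>i. of_bool (i = I_b_bp))"
| "bcoef_exp Olc = (\<lambda>i. of_bool (i = I_b_olc))"
| "bcoef_exp Olh = (\<lambda>i. of_bool (i = I_b_olh))"
| "bcoef_exp Nl = (\<lambda>i. (of_bool (i = I_b_bp) + of_bool (i = I_b_olh)) / 2)"

lemma acoef_mono: "acoef t = mon (acoef_exp t)"
  by (cases t) (simp_all add: mono_simps field_simps)

lemma bcoef_mono: "bcoef t = mon (bcoef_exp t)"
  by (cases t) (simp_all add: mono_simps field_simps)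

lemma coef_in_coeff_ring: "acoef t \<in> coeff_ring" "bcoef t \<in> coeff_ring"
  unfolding acoef_mono bcoef_mono mono_in_coeff_ring half_exponents_def
  by (cases t; auto)+

section \<open>The state sum\<close>

text \<open>After substitution into \<open>T_ps\<close> the exponents of \<open>\<alpha>\<close>, \<open>\<beta>\<close> and \<open>\<gamma>\<close> collapse to these counts; for \<open>\<gamma>\<close>,
  because \<open>card (verts G) + card A - 2 * rho G A = bcount G A\<close>.\<close>

definition state_exp :: "'a coloured_ribbon_graph \<Rightarrow> 'a set set \<Rightarrow> indet \<Rightarrow> rat" where
  "state_exp G A i = (case i of
     I_alpha \<Rightarrow> of_nat (kV G A)
   | I_beta \<Rightarrow> of_nat (kB G (edges G - A))
   | I_gamma \<Rightarrow> of_nat (bcount G A)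
   | I_a_bs \<Rightarrow> r1 G (edges G) - r1 G A
   | I_a_bp \<Rightarrow> r2 G (edges G) - r2 G A
   | I_a_olc \<Rightarrow> r3 G (edges G) - r3 G A
   | I_a_olh \<Rightarrow> r4 G (edges G) - r4 G A
   | I_b_bs \<Rightarrow> r1 G A
   | I_b_bp \<Rightarrow> r2 G A
   | I_b_olc \<Rightarrow> r3 G A
   | I_b_olh \<Rightarrow> r4 G A)"

definition state_sum :: "'a coloured_ribbon_graph \<Rightarrow> indet fpoly" where
  "state_sum G = (\<Sum>A\<in>Pow (edges G). mon (state_exp G A))"

lemma mrank_vgraph: "mrank (vgraph G) A = of_nat (kV G {}) - of_nat (kV G A)"
  by (simp add: mrank_def kV_def[of _ A] kV_empty) (simp add: vgraph_def)

lemma mrank_bgraph: "mrank (bgraph G) A = of_nat (kB G {}) - of_nat (kB G A)"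
  by (simp add: mrank_def kB_def[of _ A] kB_empty) (simp add: bgraph_def)

lemma rho_bcount: "rho G A = (of_nat (card A) + of_nat (bcount G {}) - of_nat (bcount G A)) / 2"
  by (simp add: rho_def bcount_empty)

lemmas r_simps = r1_def r2_def r3_def r4_def mrank_vgraph mrank_bgraph rho_bcount

text \<open>Moving the prefactor into the sum leaves, for each \<open>A\<close>, one linear identity
  per indeterminate. The prefactor turns the divisions into differences, such as
  \<open>r3 G (edges G) - r3 G A\<close> for \<open>I_a_olc\<close>.\<close>

lemma state_sum_T_ps:
  "\<alpha> ^ mcomps (vgraph G) * \<beta> ^ mcomps (bgraph G)
     * \<gamma> \<up> (of_nat (card (verts G)) - rho G (edges G))
     * bcoef Bs \<up> r1 G (edges G) * bcoef Bp \<up> r2 G (edges G)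
     * acoef Olc \<up> r3 G (edges G) * acoef Olh \<up> r4 G (edges G)
     * T_ps G (\<alpha> * \<gamma> * acoef Bs \<oslash> bcoef Bs) (\<gamma> * acoef Bp \<oslash> bcoef Bp)
              (\<beta> * \<gamma> * bcoef Olc \<oslash> acoef Olc) (\<gamma> * bcoef Olh \<oslash> acoef Olh) = state_sum G"
  (is "?pre * T_ps G ?w ?x ?y ?z = _")
proof -
  have comps: "mcomps (vgraph G) = kV G (edges G)" "mcomps (bgraph G) = kB G (edges G)"
    by (simp_all add: mcomps_def kV_def kB_def vgraph_def bgraph_def)
  have "?pre * (?w \<up> (r1 G (edges G) - r1 G A) * ?x \<up> (r2 G (edges G) - r2 G A) * ?y \<up> r3 G A * ?z \<up> r4 G A)
    = mon (state_exp G A)" for A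
    unfolding acoef.simps bcoef.simps mono_simps comps
  proof (intro arg_cong[where f = mon] ext, goal_cases)
    case (1 i)
    show ?case
      by (cases i) (simp_all add: state_exp_def r_simps bcount_empty[symmetric] field_simps)
  qed
  then show ?thesis
    by (simp add: T_ps_def state_sum_def sum_distrib_left)
qed

text \<open>The displaced reference values are \<open>kV\<close> and \<open>bcount\<close> at E,
  which move to E - e, and \<open>kB\<close> at \<open>{}\<close>, which moves to
  \<open>{e}\<close>. They enter the exponents of the a-indeterminates only, and the displacements
  are those recorded by \<open>i\<close>.\<close>

lemma state_exp_delete:
  assumes G: "coloured_ribbon_graph G" and e: "e \<in> edges G" and t: "has_type G e (i, j)"
    and A: "A \<subseteq> edges G - {e}"
  shows "state_exp G A k = acoef_exp i k + state_exp (delete e G) A k"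
proof -
  note R = coloured_ribbon_graphD(1)[OF G]
  have E: "insert e (edges G - {e}) = edges G" "insert e (edges G - {e} - A) = edges G - A"
    using e A by auto
  have cardE: "rat_of_nat (card (edges G)) = rat_of_nat (card (edges G - {e})) + 1"
    using card_Suc_Diff1[OF finite_edges[OF R] e] by (metis of_nat_Suc add.commute)
  have kB: "kB (delete e G) (edges G - {e}) = kB G (edges G)"
    "kB (delete e G) (edges G - {e} - A) = kB G (edges G - A)"
    "kB (delete e G) {} = kB G {e}"
    using kB_delete[OF G e, of "edges G - {e}"] kB_delete[OF G e, of "edges G - {e} - A"]
      kB_delete[OF G e, of "{}"] unfolding E by auto
  have b: "bcount (delete e G) (edges G - {e}) = bcount G (edges G - {e})"
    "bcount (delete e G) A = bcount G A" "bcount (delete e G) {} = bcount G {}"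
    using A by (auto intro!: bcount_delete[OF R e])
  note c = has_type_counts[OF G e t]
  have c': "rat_of_nat (kV G (edges G - {e})) = rat_of_nat (kV G (edges G)) + of_bool (i = Bs)"
    "rat_of_nat (kB G {}) = rat_of_nat (kB G {e}) + of_bool (i = Olc)"
    "rat_of_nat (bcount G (edges G - {e})) = rat_of_nat (bcount G (edges G)) + rho_defect i"
    using c(1-3) by (simp_all add: algebra_simps)
  show ?thesis
    unfolding state_exp_def r_simps edges_delete[OF R e] kV_delete kB b c' cardE Diff_cancel
    by (cases i; cases k; simp add: kB b c' field_simps)
qed

text \<open>Here \<open>kV\<close> and \<open>bcount\<close> are displaced from \<open>{}\<close> to
  \<open>{e}\<close> and \<open>kB\<close> from E to E - e. This affects only the exponents of the
  b-indeterminates, as recorded by \<open>j\<close>.\<close>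

lemma state_exp_contract:
  assumes G: "coloured_ribbon_graph G" and e: "e \<in> edges G" and t: "has_type G e (i, j)"
    and A: "A \<subseteq> edges G - {e}"
  shows "state_exp G (insert e A) k = bcoef_exp j k + state_exp (contract e G) A k"
proof -
  note R = coloured_ribbon_graphD(1)[OF G]
  have E: "insert e (edges G - {e}) = edges G" "edges G - insert e A = edges G - {e} - A"
    using e A by auto
  have fin: "finite A" using A finite_edges[OF R] finite_subset by blast
  have cardE: "rat_of_nat (card (edges G)) = rat_of_nat (card (edges G - {e})) + 1"
    using card_Suc_Diff1[OF finite_edges[OF R] e] by (metis of_nat_Suc add.commute)
  have cardA: "rat_of_nat (card (insert e A)) = rat_of_nat (card A) + 1"
    using A fin by (subst card_insert_disjoint) auto
  have kV: "kV (contract e G) (edges G - {e}) = kV G (edges G)"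
    "kV (contract e G) A = kV G (insert e A)" "kV (contract e G) {} = kV G {e}"
    using kV_contract[OF G e, of "edges G - {e}"] kV_contract[OF G e A]
      kV_contract[OF G e, of "{}"] unfolding E by auto
  have b: "bcount (contract e G) (edges G - {e}) = bcount G (edges G)"
    "bcount (contract e G) A = bcount G (insert e A)" "bcount (contract e G) {} = bcount G {e}"
    using bcount_contract[OF R e, of "edges G - {e}"] bcount_contract[OF R e A]
      bcount_contract[OF R e, of "{}"] unfolding E by auto
  note c = has_type_counts[OF G e t]
  have c': "rat_of_nat (kV G {}) = rat_of_nat (kV G {e}) + of_bool (j = Bs)"
    "rat_of_nat (kB G (edges G - {e})) = rat_of_nat (kB G (edges G)) + of_bool (j = Olc)"
    "rat_of_nat (bcount G {}) = rat_of_nat (bcount G {e}) + rho_defect j"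
    using c(4-6) by (simp_all add: algebra_simps)
  show ?thesis
    unfolding state_exp_def r_simps edges_contract[OF R e] kB_contract kV b c' cardE cardA E Diff_cancel
    by (cases j; cases k; simp add: kV b c' field_simps)
qed

text \<open>Subsets without \<open>e\<close> give the deletion term, and subsets containing
  \<open>e\<close> give the contraction term.\<close>

lemma state_sum_recursion:
  assumes G: "coloured_ribbon_graph G" and e: "e \<in> edges G" and t: "has_type G e (i, j)"
  shows "state_sum G = acoef i * state_sum (delete e G) + bcoef j * state_sum (contract e G)"
proof -
  note R = coloured_ribbon_graphD(1)[OF G]
  define E where "E = edges G - {e}"
  have E: "edges G = insert e E" "e \<notin> E" "finite E"
    using e finite_edges[OF R] by (auto simp: E_def)
  have inj: "inj_on (insert e) (Pow E)" using E(2) by (auto simp: inj_on_def)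
  have "state_sum G = (\<Sum>A\<in>Pow E. mon (state_exp G A)) + (\<Sum>A\<in>insert e ` Pow E. mon (state_exp G A))"
    unfolding state_sum_def E(1) Pow_insert using E(2,3) by (intro sum.union_disjoint) auto
  also have "(\<Sum>A\<in>insert e ` Pow E. mon (state_exp G A)) = (\<Sum>A\<in>Pow E. mon (state_exp G (insert e A)))"
    by (simp add: sum.reindex[OF inj])
  also have "(\<Sum>A\<in>Pow E. mon (state_exp G (insert e A))) = bcoef j * state_sum (contract e G)"
    unfolding state_sum_def edges_contract[OF R e] E_def[symmetric] sum_distrib_left bcoef_mono mono_mult
    by (intro sum.cong refl arg_cong[where f = mon] ext state_exp_contract[OF G e t]) (simp add: E_def)
  also have "(\<Sum>A\<in>Pow E. mon (state_exp G A)) = acoef i * state_sum (delete e G)"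
    unfolding state_sum_def edges_delete[OF R e] E_def[symmetric] sum_distrib_left acoef_mono mono_mult
    by (intro sum.cong refl arg_cong[where f = mon] ext state_exp_delete[OF G e t]) (simp add: E_def)
  finally show ?thesis .
qed

lemma state_sum_edgeless:
  assumes "edges G = {}"
  shows "state_sum G = \<alpha> ^ card (vclasses G) * \<beta> ^ card (bclasses G) * \<gamma> ^ card (verts G)"
proof -
  have "state_exp G {} = (\<lambda>i. of_nat (card (vclasses G)) * of_bool (i = I_alpha)
      + of_nat (card (bclasses G)) * of_bool (i = I_beta)
      + of_nat (card (verts G)) * of_bool (i = I_gamma))"
  proof
    show "state_exp G {} i = of_nat (card (vclasses G)) * of_bool (i = I_alpha)
      + of_nat (card (bclasses G)) * of_bool (i = I_beta)
      + of_nat (card (verts G)) * of_bool (i = I_gamma)" for i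
      by (cases i) (simp_all add: state_exp_def assms r_simps kV_empty kB_empty bcount_empty)
  qed
  then show ?thesis
    unfolding mono_simps by (simp add: state_sum_def assms)
qed

section \<open>Existence, uniqueness and integrality\<close>

lemma satisfies_recursion_state_sum:
  assumes "\<And>G. G \<in> \<G> \<Longrightarrow> coloured_ribbon_graph G"
  shows "satisfies_recursion \<G> state_sum"
  unfolding satisfies_recursion_def
  using assms state_sum_recursion state_sum_edgeless by blast

text \<open>Every edge has some type, so a graph with edges can always be unfolded at one chosen
  edge.\<close>

lemma minor_induct [consumes 3, case_names edgeless step]:
  assumes "G \<in> \<G>" "minor_closed \<G>" "\<forall>G\<in>\<G>. coloured_ribbon_graph G"
    and edgeless: "\<And>G. G \<in> \<G> \<Longrightarrow> edges G = {} \<Longrightarrow> Q G"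
    and step: "\<And>G e i j. G \<in> \<G> \<Longrightarrow> e \<in> edges G \<Longrightarrow> has_type G e (i, j) \<Longrightarrow>
      Q (delete e G) \<Longrightarrow> Q (contract e G) \<Longrightarrow> Q G"
  shows "Q G"
  using assms(1)
proof (induction "card (edges G)" arbitrary: G rule: less_induct)
  case less
  note G = assms(3)[rule_format, OF less.prems]
  note R = coloured_ribbon_graphD(1)[OF G]
  show ?case
  proof (cases "edges G = {}")
    case True
    then show ?thesis using edgeless less.prems by blast
  next
    case False
    then obtain e where e: "e \<in> edges G" by blast
    obtain i j where t: "has_type G e (i, j)" by (rule has_type_exists[OF G])
    have "card (edges G - {e}) < card (edges G)"
      using finite_edges[OF R] e by (rule card_Diff1_less)
    moreover have "delete e G \<in> \<G>" "contract e G \<in> \<G>"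
      using assms(2) less.prems e by (auto simp: minor_closed_def)
    ultimately have "Q (delete e G)" "Q (contract e G)"
      using less.hyps edges_delete[OF R e] edges_contract[OF R e] by auto
    then show ?thesis using step less.prems e t by blast
  qed
qed

lemma satisfies_recursion_unique:
  assumes "satisfies_recursion \<G> U" "satisfies_recursion \<G> U'"
    and "minor_closed \<G>" "\<forall>G\<in>\<G>. coloured_ribbon_graph G" "G \<in> \<G>"
  shows "U G = U' G"
  using assms(5,3,4)
proof (induction rule: minor_induct)
  case (edgeless G)
  then show ?case using assms(1,2) by (simp add: satisfies_recursion_def)
next
  case (step G e i j)
  then have "U G = acoef i * U (delete e G) + bcoef j * U (contract e G)"
    "U' G = acoef i * U' (delete e G) + bcoef j * U' (contract e G)"
    using assms(1,2) unfolding satisfies_recursion_def by blast+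
  then show ?case using step by simp
qed

text \<open>The rank differences in the state sum are not visibly nonnegative or half-integral. The
  recursion avoids this question: its coefficients and the edgeless values lie in the ring, which is
  closed under sums and products.\<close>

lemma satisfies_recursion_coeff_ring:
  assumes U: "satisfies_recursion \<G> U"
    and "minor_closed \<G>" "\<forall>G\<in>\<G>. coloured_ribbon_graph G" "G \<in> \<G>"
  shows "U G \<in> coeff_ring"
  using assms(4,2,3)
proof (induction rule: minor_induct)
  case (edgeless G)
  then have "U G = \<alpha> ^ card (vclasses G) * \<beta> ^ card (bclasses G) * \<gamma> ^ card (verts G)"
    using U by (simp add: satisfies_recursion_def)
  then show ?case
    by (auto simp: mono_simps mono_in_coeff_ring half_exponents_def)
next
  case (step G e i j)
  then have "U G = acoef i * U (delete e G) + bcoef j * U (contract e G)"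
    using U unfolding satisfies_recursion_def by blast
  then show ?case using step by (auto intro: coeff_ring_add coeff_ring_mult coef_in_coeff_ring)
qed

theorem theorem3p5:
  fixes \<G> :: "'a coloured_ribbon_graph set"
  assumes "\<And>G. G \<in> \<G> \<Longrightarrow> coloured_ribbon_graph G"
    and "minor_closed \<G>"
  shows "(\<exists>!U. U \<in> \<G> \<rightarrow>\<^sub>E coeff_ring \<and> satisfies_recursion \<G> U) \<and>
    (\<forall>U. U \<in> \<G> \<rightarrow>\<^sub>E coeff_ring \<and> satisfies_recursion \<G> U \<longrightarrow>
      (\<forall>G\<in>\<G>. U G =
        \<alpha> ^ mcomps (vgraph G) * \<beta> ^ mcomps (bgraph G)
        * \<gamma> \<up> (of_nat (card (verts G)) - rho G (edges G))
        * bcoef Bs \<up> r1 G (edges G) * bcoef Bp \<up> r2 G (edges G)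
        * acoef Olc \<up> r3 G (edges G) * acoef Olh \<up> r4 G (edges G)
        * T_ps G (\<alpha> * \<gamma> * acoef Bs \<oslash> bcoef Bs) (\<gamma> * acoef Bp \<oslash> bcoef Bp)
                 (\<beta> * \<gamma> * bcoef Olc \<oslash> acoef Olc) (\<gamma> * bcoef Olh \<oslash> acoef Olh)))"
proof -
  have coloured: "\<forall>G\<in>\<G>. coloured_ribbon_graph G"
    using assms(1) by blast
  \<comment> \<open>Since the class is minor-closed, the recursion evaluates \<open>U\<close> only
    inside it. This permits passing to the extensional functions for which uniqueness is
    stated.\<close>
  have restrict: "satisfies_recursion \<G> (restrict U \<G>) \<longleftrightarrow> satisfies_recursion \<G> U" for U
    using assms(2) by (auto simp: satisfies_recursion_def minor_closed_def)
  define F where "F = restrict (state_sum :: 'a coloured_ribbon_graph \<Rightarrow> _) \<G>"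
  have F: "satisfies_recursion \<G> F"
    unfolding F_def restrict by (rule satisfies_recursion_state_sum) (rule assms(1))
  have F_ring: "F \<in> \<G> \<rightarrow>\<^sub>E coeff_ring"
    using satisfies_recursion_coeff_ring[OF F assms(2) coloured] unfolding F_def by auto
  have eq: "U = F" if "U \<in> \<G> \<rightarrow>\<^sub>E coeff_ring" "satisfies_recursion \<G> U" for U
  proof (rule PiE_ext[OF that(1)])
    show "F \<in> \<G> \<rightarrow>\<^sub>E coeff_ring" by (rule F_ring)
    show "U G = F G" if "G \<in> \<G>" for G
      using satisfies_recursion_unique[OF \<open>satisfies_recursion \<G> U\<close> F assms(2) coloured that] by simp
  qed
  show ?thesis
    unfolding state_sum_T_ps
  proof (intro conjI ex1I[of _ F] allI ballI impI)
    show "F \<in> \<G> \<rightarrow>\<^sub>E coeff_ring" "satisfies_recursion \<G> F" by (rule F_ring F)+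
    show "U = F" if "U \<in> \<G> \<rightarrow>\<^sub>E coeff_ring \<and> satisfies_recursion \<G> U" for U
      using that eq by blast
    show "U G = state_sum G"
      if "U \<in> \<G> \<rightarrow>\<^sub>E coeff_ring \<and> satisfies_recursion \<G> U" "G \<in> \<G>" for U G
    proof -
      have "U = F" using that(1) by (intro eq) auto
      then show ?thesis using that(2) by (simp add: F_def)
    qed
  qed
qed

end
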